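(* Let $a\in L^1(I)$ and $\lambda\in\mathbb{R}$. If the operator $L[\lambda]$ is nonresonant in $X_D$ and in $X_{M_2}$, then for all $(t,s)\in I\times I$ $$G_{M_2}[\lambda](t,s)=G_D[\lambda](t,s)+r_2[\lambda](t)\,G_{M_2}[\lambda](1,s)$$ $$=G_D[\lambda](t,s)+\frac{\partial}{\partial s}G_D[\lambda](t,1)\,G_{M_2}[\lambda](1,s).$$
   Context: $I=[0,1]$, $a\in L^1(I)$ is real-valued, $\lambda\in\mathbb{R}$, and $L[\lambda]u(t)=u''(t)+(a(t)+\lambda)u(t)$. $W^{2,1}(I)=\{u\in C(I):u'\in AC(I)\}$, where $AC(I)$ is the set of absolutely continuous functions on $I$. $X_D=\{u\in W^{2,1}(I):u(0)=u(1)=0\}$ (Dirichlet) and $X_{M_2}=\{u\in W^{2,1}(I):u(0)=u'(1)=0\}$ (Mixed 2). $L[\lambda]$ is nonresonant in $X$ if $u=0$ is the only $u\in X$ with $L[\lambda]u=0$ a.e. on $I$. In that case, for every $\sigma\in L^1(I)$ the problem $L[\lambda]u=\sigma$ a.e. on $I$, $u\in X$, has a unique solution, given by $u(t)=\int_0^1G(t,s)\sigma(s)\,ds$, where the continuous function $G:I\times I\to\mathbb{R}$ is the Green's function; it is denoted $G_D[\lambda]$ for $X=X_D$ and $G_{M_2}[\lambda]$ for $X=X_{M_2}$. $r_2[\lambda]$ is the unique solution of $L[\lambda]u=0$ a.e. on $I$, $u(0)=0$, $u(1)=1$. Convention: $\frac{\partial}{\partial s}G(t,1)$ is the (one-sided)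 derivative for $t\in(0,1)$, extended by continuity to $t\in\{0,1\}$. *)

theory Defs
  imports "HOL-Analysis.Analysis"
begin

abbreviation I01 :: "real set" where
  "I01 \<equiv> {0..1}"

abbreviation leb01 :: "real measure" where
  "leb01 \<equiv> lebesgue_on I01"

definition absolutely_continuous_on :: "real set \<Rightarrow> (real \<Rightarrow> real) \<Rightarrow> bool" where
  "absolutely_continuous_on S f \<longleftrightarrow>
     (\<forall>\<epsilon>>0. \<exists>\<delta>>0. \<forall>\<D>. \<D> division_of \<Union>\<D> \<and> \<Union>\<D> \<subseteq> S \<and> (\<Sum>K\<in>\<D>. Sup K - Inf K) < \<delta> \<longrightarrow>
        (\<Sum>K\<in>\<D>. \<bar>f (Sup K) - f (Inf K)\<bar>) < \<epsilon>)"

text \<open>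
  Functions on the unit interval are represented by functions on the whole real line of which only
  the values on \<open>I01\<close> matter. In particular, derivatives are taken relative to \<open>I01\<close>, hence are
  one-sided at the end points.
\<close>

definition deriv01 :: "(real \<Rightarrow> real) \<Rightarrow> real \<Rightarrow> real" where
  "deriv01 u t = vector_derivative u (at t within I01)"

definition W21 :: "(real \<Rightarrow> real) set" where
  "W21 = {u. continuous_on I01 u \<and> u differentiable_on I01 \<and>
             absolutely_continuous_on I01 (deriv01 u)}"

definition X_D :: "(real \<Rightarrow> real) set" where
  "X_D = {u \<in> W21. u 0 = 0 \<and> u 1 = 0}"

definition X_M2 :: "(real \<Rightarrow> real) set" where
  "X_M2 = {u \<in> W21. u 0 = 0 \<and> deriv01 u 1 = 0}"

text \<open>
  The parameter \<open>lam\<close> stands for \<open>\<lambda>\<close>. For \<open>u \<in> W21\<close> the second derivative exists almost everywhere,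
  and \<open>hill_op\<close> is only ever compared almost everywhere.
\<close>

definition hill_op :: "(real \<Rightarrow> real) \<Rightarrow> real \<Rightarrow> (real \<Rightarrow> real) \<Rightarrow> real \<Rightarrow> real" where
  "hill_op a lam u t = deriv01 (deriv01 u) t + (a t + lam) * u t"

definition nonresonant :: "(real \<Rightarrow> real) \<Rightarrow> real \<Rightarrow> (real \<Rightarrow> real) set \<Rightarrow> bool" where
  "nonresonant a lam X \<longleftrightarrow>
     (\<forall>u\<in>X. (AE t in leb01. hill_op a lam u t = 0) \<longrightarrow> (\<forall>t\<in>I01. u t = 0))"

text \<open>
  The equivalence expresses both that \<open>t \<mapsto> \<integral> G(t,s) \<sigma>(s) ds\<close> solves the boundary value problem
  and that, on \<open>I01\<close>, it is the only solution.
\<close>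

definition is_green_function ::
    "(real \<Rightarrow> real) \<Rightarrow> real \<Rightarrow> (real \<Rightarrow> real) set \<Rightarrow> (real \<Rightarrow> real \<Rightarrow> real) \<Rightarrow> bool" where
  "is_green_function a lam X G \<longleftrightarrow>
     continuous_on (I01 \<times> I01) (\<lambda>(t, s). G t s) \<and>
     (\<forall>\<sigma>. integrable leb01 \<sigma> \<longrightarrow>
        (\<forall>u. (u \<in> X \<and> (AE t in leb01. hill_op a lam u t = \<sigma> t)) \<longleftrightarrow>
             (\<forall>t\<in>I01. u t = (LINT s|leb01. G t s * \<sigma> s))))"

text \<open>
  The Green's function and the function \<open>r2\<close> below are unique on \<open>I01 \<times> I01\<close> and \<open>I01\<close>,
  respectively, but not outside; therefore \<open>SOME\<close> rather than \<open>THE\<close>.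
\<close>

definition green :: "(real \<Rightarrow> real) \<Rightarrow> real \<Rightarrow> (real \<Rightarrow> real) set \<Rightarrow> real \<Rightarrow> real \<Rightarrow> real" where
  "green a lam X = (SOME G. is_green_function a lam X G)"

abbreviation G_D :: "(real \<Rightarrow> real) \<Rightarrow> real \<Rightarrow> real \<Rightarrow> real \<Rightarrow> real" where
  "G_D a lam \<equiv> green a lam X_D"

abbreviation G_M2 :: "(real \<Rightarrow> real) \<Rightarrow> real \<Rightarrow> real \<Rightarrow> real \<Rightarrow> real" where
  "G_M2 a lam \<equiv> green a lam X_M2"

definition r2 :: "(real \<Rightarrow> real) \<Rightarrow> real \<Rightarrow> real \<Rightarrow> real" where
  "r2 a lam = (SOME u. u \<in> W21 \<and> (AE t in leb01. hill_op a lam u t = 0) \<and> u 0 = 0 \<and> u 1 = 1)"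

text \<open>
  The one-sided derivative of \<open>G\<close> in its second argument at \<open>s = 1\<close>, taken literally for
  \<open>t \<in> (0,1)\<close> and extended by continuity to the end points.
\<close>

definition ds_at_1 :: "(real \<Rightarrow> real \<Rightarrow> real) \<Rightarrow> real \<Rightarrow> real" where
  "ds_at_1 G t =
     (if t \<in> {0<..<1} then deriv01 (G t) 1
      else Lim (at t within {0<..<1}) (\<lambda>\<tau>. deriv01 (G \<tau>) 1))"

definition ds_at_1_exists :: "(real \<Rightarrow> real \<Rightarrow> real) \<Rightarrow> bool" where
  "ds_at_1_exists G \<longleftrightarrow>
     (\<forall>t\<in>{0<..<1}. G t differentiable (at 1 within I01)) \<and>
     (\<forall>t\<in>{0, 1}. \<exists>l. ((\<lambda>\<tau>. deriv01 (G \<tau>) 1) \<longlongrightarrow> l) (at t within {0<..<1}))"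

end

theory Submission
  imports Defs
begin

text \<open>
  Write \<open>q = a + lam\<close>, and let \<open>K t s\<close> be the Cauchy kernel: zero for \<open>t \<le> s\<close>, and for \<open>t \<ge> s\<close> the
  solution of \<open>u'' + q u = 0\<close> with \<open>u s = 0\<close> and \<open>u' s = 1\<close>. By variation of constants, the solutions
  of \<open>u'' + q u = \<sigma>\<close> with \<open>u 0 = 0\<close> are the integrals of \<open>K t s * \<sigma> s\<close> plus multiples of
  \<open>\<phi> t = K t 0\<close>. Choosing the multiple so that the condition at \<open>1\<close> holds gives
  \<open>G_D t s = K t s - \<phi> t * K 1 s / \<phi> 1\<close> and
  \<open>G_M2 t s = K t s - \<phi> t * E s / \<phi>' 1\<close>, where \<open>E s\<close> is the derivative of \<open>\<lambda>t. K t s\<close> at \<open>1\<close>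
  for \<open>s < 1\<close>; nonresonance says exactly that \<open>\<phi> 1\<close> and \<open>\<phi>' 1\<close> do not vanish. Since \<open>r2 = \<phi> / \<phi> 1\<close>, the first
  identity is elementary algebra. For the second, \<open>K t s = 0\<close> when \<open>s\<close> is near \<open>1\<close> and \<open>t < 1\<close>, while
  \<open>\<lambda>s. K 1 s\<close> has derivative \<open>-1\<close> at \<open>1\<close>; hence the derivative of \<open>G_D t\<close> at \<open>1\<close> is \<open>r2 t\<close>. The lemmas
  that carry this are \<open>Cauchy_kernel_exists\<close>, \<open>shooting_solution\<close>, \<open>K_1_has_derivative\<close> and
  \<open>is_green_function_unique\<close>.

  Because \<open>a\<close> is merely integrable, the equation holds only almost everywhere. All solutions are
  constructed from integral equations, and two facts translate between these and \<open>W21\<close>: the primitive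
  of an integrable function has that function as its derivative almost everywhere
  (\<open>primitive_has_derivative_AE\<close>), and every absolutely continuous function is differentiable almost
  everywhere (\<open>absolutely_continuous_on_differentiable_AE\<close>). The second is needed to subtract two
  arbitrary solutions in \<open>W21\<close> before applying nonresonance. Both facts are proved with Vitali's
  covering theorem: the growth of a function over steep intervals that almost fill a set of positive
  measure contradicts what the density, or absolute continuity and less steep intervals that almost
  fill the same set, allow.
\<close>

abbreviation incr :: "(real \<Rightarrow> real) \<Rightarrow> real set \<Rightarrow> real" where
  "incr f K \<equiv> f (Sup K) - f (Inf K)"

section \<open>Increments over divisions\<close>

lemma interval_of_division:
  fixes K :: "real set"
  assumes "\<D> division_of S" "K \<in> \<D>"
  shows "K = {Inf K..Sup K}" "Inf K \<le> Sup K" "measure lebesgue K = Sup K - Inf K"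
proof -
  obtain a b where K: "K = {a..b}" "K \<noteq> {}"
    using division_ofD(3,4)[OF assms] by auto
  then show "K = {Inf K..Sup K}" "Inf K \<le> Sup K" "measure lebesgue K = Sup K - Inf K"
    by auto
qed

lemma measure_division:
  fixes S :: "real set"
  assumes "\<D> division_of S"
  shows "measure lebesgue S = (\<Sum>K\<in>\<D>. Sup K - Inf K)"
proof -
  note d = division_ofD[OF assms]
  have "measure lebesgue (\<Union>\<D>) = (\<Sum>K\<in>\<D>. measure lebesgue K)"
  proof (rule measure_negligible_finite_Union)
    show "finite \<D>" by (rule d)
    show "K \<in> lmeasurable" if "K \<in> \<D>" for K using d(4)[OF that] by auto
    show "pairwise (\<lambda>S T. negligible (S \<inter> T)) \<D>"
    proof (clarsimp simp: pairwise_def)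
      fix K L assume KL: "K \<in> \<D>" "L \<in> \<D>" "K \<noteq> L"
      have "convex (K \<inter> L)" using d(4)[OF KL(1)] d(4)[OF KL(2)] by (auto intro: convex_Int)
      moreover have "interior (K \<inter> L) = {}" using d(5)[OF KL] by simp
      ultimately show "negligible (K \<inter> L)" using negligible_convex_interior by blast
    qed
  qed
  also have "\<dots> = (\<Sum>K\<in>\<D>. Sup K - Inf K)"
    by (rule sum.cong) (auto simp: interval_of_division(3)[OF assms])
  finally show ?thesis using d(6) by simp
qed

lemma sum_incr_division_interval:
  fixes f :: "real \<Rightarrow> real"
  assumes "\<D> division_of {a..b}" "a \<le> b"
  shows "(\<Sum>K\<in>\<D>. incr f K) = f b - f a"
proof -
  let ?f = "(\<lambda>K::real set. if K = {} then 0 else f(interval_upperbound K) - f(interval_lowerbound K))"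
  interpret operative_real plus 0 ?f
    rewrites "comm_monoid_set.F (+) 0 = sum"
    by standard[1] (auto simp add: sum_def)
  have "sum ?f \<D> = ?f {a..b}"
    using division[of \<D> a b] assms by simp
  moreover have "sum ?f \<D> = (\<Sum>K\<in>\<D>. incr f K)"
    by (rule sum.cong) (use division_ofD(3)[OF assms(1)] division_ofD(4)[OF assms(1)] in force)+
  ultimately show ?thesis using assms by simp
qed

text \<open>
  The gaps \<open>\<G>\<close> are what \<open>\<J>\<close> leaves uncovered in \<open>\<Union>\<I>\<close>. The same \<open>\<G>\<close> serves every \<open>f\<close>: extending
  both \<open>\<I>\<close> and \<open>\<J> \<union> \<G>\<close> by one division of the complement turns both into divisions of a large
  interval, over which all increments telescope. With \<open>f\<close> the identity, the formula gives the total
  length of the gaps.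
\<close>

lemma extend_division_with_gaps:
  fixes \<I> \<J> :: "real set set"
  assumes I: "\<I> division_of \<Union>\<I>" and J: "\<J> division_of \<Union>\<J>" and sub: "\<Union>\<J> \<subseteq> \<Union>\<I>"
  obtains \<G> where "\<G> division_of \<Union>\<G>" "\<Union>\<G> \<subseteq> \<Union>\<I>"
    "\<And>f. (\<Sum>K\<in>\<I>. incr f K) = (\<Sum>K\<in>\<J>. incr f K) + (\<Sum>K\<in>\<G>. incr f K)"
proof -
  obtain r where r: "\<J> \<subseteq> r" "r division_of \<Union>\<I>"
    using partial_division_extend[OF J I sub] by blast
  obtain a b where ab: "\<Union>\<I> \<subseteq> {a..b}" "a \<le> b"
  proof -
    have "bounded (\<Union>\<I>)" using I by (rule elementary_bounded)
    then obtain B where "\<And>x. x \<in> \<Union>\<I> \<Longrightarrow> \<bar>x\<bar> \<le> B" by (auto simp: bounded_real)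
    then have "\<Union>\<I> \<subseteq> {-\<bar>B\<bar>..\<bar>B\<bar>}" by force
    then show ?thesis using that[of "-\<bar>B\<bar>" "\<bar>B\<bar>"] by simp
  qed
  obtain w where w: "\<I> \<subseteq> w" "w division_of {a..b}"
    using partial_division_extend_interval[of \<I> a b] I ab by auto
  let ?R = "w - \<I>"
  have R: "?R division_of \<Union>?R" using division_of_subset[of w ?R] w(2) division_ofD(6)[OF w(2)] by simp
  have dw: "finite w" and int: "\<And>K L. K \<in> w \<Longrightarrow> L \<in> w \<Longrightarrow> K \<noteq> L \<Longrightarrow> interior K \<inter> interior L = {}"
    and cb: "\<And>K. K \<in> w \<Longrightarrow> \<exists>a b. K = cbox a b"
    using division_ofD[OF w(2)] by auto
  have *: "interior L \<inter> interior (\<Union>\<I>) = {}" if "L \<in> ?R" for L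
  proof (rule Int_interior_Union_intervals)
    show "finite \<I>" using w(1) dw by (rule finite_subset)
    show "\<exists>a b. T = cbox a b" if "T \<in> \<I>" for T using that w(1) cb by blast
    show "interior L \<inter> interior T = {}" if "T \<in> \<I>" for T
      using int[of L T] that \<open>L \<in> ?R\<close> w(1) by blast
  qed simp
  have dis: "interior (\<Union>\<I>) \<inter> interior (\<Union>?R) = {}"
  proof (rule Int_interior_Union_intervals)
    show "interior (\<Union>\<I>) \<inter> interior T = {}" if "T \<in> ?R" for T using *[OF that] by blast
    show "\<exists>a b. T = cbox a b" if "T \<in> ?R" for T using that cb by blast
  qed (use dw in auto)
  have un: "\<Union>\<I> \<union> \<Union>?R = {a..b}" unfolding division_ofD(6)[OF w(2), symmetric] using w(1) by blast
  have "(r \<union> ?R) division_of {a..b}"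
    using division_disjoint_union[OF r(2) R dis] un by simp
  from sum_incr_division_interval[OF this ab(2)] sum_incr_division_interval[OF w(2) ab(2)]
  have eq: "(\<Sum>K\<in>r \<union> ?R. incr f K) = (\<Sum>K\<in>w. incr f K)" for f by simp
  \<comment> \<open>a member of both would be a degenerate interval, which contributes nothing to either sum\<close>
  have z: "incr f K = 0" if "K \<in> r \<inter> ?R" for f K
  proof -
    have "interior K \<subseteq> interior (\<Union>\<I>) \<inter> interior (\<Union>?R)"
      using that division_ofD(2)[OF r(2)] by (metis IntD1 IntD2 Int_greatest Union_upper interior_mono)
    then have "interior K = {}" using dis by auto
    moreover have K: "K = {Inf K..Sup K}" "Inf K \<le> Sup K"
      using interval_of_division[OF r(2), of K] that by auto
    ultimately have "{Inf K<..<Sup K} = {}" using interior_atLeastAtMost_real[of "Inf K" "Sup K"] by simp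
    with K(2) have "Inf K = Sup K" by simp
    then show ?thesis by simp
  qed
  have fr: "finite r" using division_ofD(1)[OF r(2)] .
  have "(\<Sum>K\<in>r. incr f K) = (\<Sum>K\<in>\<I>. incr f K)" for f
  proof -
    have "(\<Sum>K\<in>r \<union> ?R. incr f K) = (\<Sum>K\<in>r. incr f K) + (\<Sum>K\<in>?R. incr f K)"
      using sum.union_inter_neutral[of r ?R "incr f"] fr dw z by auto
    moreover have "(\<Sum>K\<in>w. incr f K) = (\<Sum>K\<in>\<I>. incr f K) + (\<Sum>K\<in>?R. incr f K)"
      using sum.subset_diff[OF w(1) dw, of "incr f"] by simp
    ultimately show ?thesis using eq[of f] by simp
  qed
  moreover have "(\<Sum>K\<in>r. incr f K) = (\<Sum>K\<in>\<J>. incr f K) + (\<Sum>K\<in>r-\<J>. incr f K)" for f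
    using sum.subset_diff[OF r(1) fr, of "incr f"] by simp
  moreover have "(r - \<J>) division_of \<Union>(r - \<J>)" using division_of_subset[of r "r - \<J>"] r(2) division_ofD(6)[OF r(2)] by simp
  moreover have "\<Union>(r - \<J>) \<subseteq> \<Union>\<I>" using division_ofD(6)[OF r(2)] by auto
  ultimately show ?thesis using that[of "r - \<J>"] by simp
qed

section \<open>Steep points and a Vitali selection\<close>

text \<open>
  For continuous \<open>f\<close>, the points at which the upper derivative exceeds \<open>v\<close>, up to the case of equality.
  Intervals with \<open>x\<close> in their interior are used, instead of difference quotients at \<open>x\<close>, to make
  this a \<open>G\<^sub>\<delta>\<close> set whatever \<open>f\<close> is.
\<close>

definition steep :: "(real \<Rightarrow> real) \<Rightarrow> real \<Rightarrow> real set" where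
  "steep f v = {x. \<forall>d>0. \<exists>p q. 0 \<le> p \<and> p < x \<and> x < q \<and> q \<le> 1 \<and> q - p < d \<and> v * (q - p) < f q - f p}"

lemma steep_subset: "steep f v \<subseteq> {0<..<1}"
proof
  fix x assume "x \<in> steep f v"
  then obtain p q where "0 \<le> p" "p < x" "x < q" "q \<le> 1"
    unfolding steep_def using zero_less_one by blast
  then show "x \<in> {0<..<1}" by simp
qed

lemma steep_lmeasurable: "steep f v \<in> lmeasurable"
proof -
  let ?U = "\<lambda>n::nat. \<Union>{{p<..<q} |p q. 0 \<le> p \<and> q \<le> 1 \<and> q - p < 1 / Suc n \<and> v * (q - p) < f q - f p}"
  have "steep f v = (\<Inter>n. ?U n)"
  proof
    show "steep f v \<subseteq> (\<Inter>n. ?U n)"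
    proof clarify
      fix x n assume "x \<in> steep f v"
      moreover have "1 / real (Suc n) > 0" by simp
      ultimately obtain p q where "0 \<le> p" "p < x" "x < q" "q \<le> 1" "q - p < 1 / Suc n" "v * (q - p) < f q - f p"
        unfolding steep_def by blast
      then have "x \<in> {p<..<q}" "{p<..<q} \<in> {{p<..<q} |p q. 0 \<le> p \<and> q \<le> 1 \<and> q - p < 1 / Suc n \<and> v * (q - p) < f q - f p}"
        by auto
      then show "x \<in> ?U n" by blast
    qed
    show "(\<Inter>n. ?U n) \<subseteq> steep f v"
      unfolding steep_def
    proof clarify
      fix x d :: real assume x: "x \<in> (\<Inter>n. ?U n)" and "d > 0"
      then obtain n where n: "inverse (Suc n) < d" using reals_Archimedean by blast
      from x have "x \<in> ?U n" by blast
      then obtain p q where "0 \<le> p \<and> q \<le> 1 \<and> q - p < 1 / Suc n \<and> v * (q - p) < f q - f p" "x \<in> {p<..<q}"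
        by blast
      with n show "\<exists>p q. 0 \<le> p \<and> p < x \<and> x < q \<and> q \<le> 1 \<and> q - p < d \<and> v * (q - p) < f q - f p"
        by (intro exI[of _ p] exI[of _ q]) (auto simp: inverse_eq_divide)
    qed
  qed
  moreover have "open (?U n)" for n by (rule open_Union) auto
  then have "(\<Inter>n. ?U n) \<in> sets borel" by (intro sets.countable_INT) (auto intro!: borel_open)
  ultimately have "steep f v \<in> sets lebesgue" by simp
  moreover have "bounded (steep f v)"
    by (rule bounded_subset[OF bounded_box[of 0 1]]) (use steep_subset in auto)
  ultimately show ?thesis by (simp add: bounded_set_imp_lmeasurable)
qed

text \<open>
  The intervals witnessing steepness form a Vitali cover of \<open>E\<close>, so countably many disjoint ones
  exhaust \<open>E\<close> up to a null set, and finitely many of these up to measure \<open>\<eta>\<close>. The measure estimate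
  uses the interior of the union so that the selection can be repeated inside it.
\<close>

lemma Vitali_steep:
  assumes E: "E \<in> lmeasurable" "E \<subseteq> steep f v" and W: "open W" "E \<subseteq> W" and "0 < \<eta>"
  obtains \<J> where "\<J> division_of \<Union>\<J>" "\<Union>\<J> \<subseteq> W \<inter> I01"
    "\<And>K. K \<in> \<J> \<Longrightarrow> v * (Sup K - Inf K) \<le> incr f K"
    "measure lebesgue (E - interior (\<Union>\<J>)) < \<eta>"
proof -
  define C where "C = {i. 0 \<le> fst i \<and> fst i < snd i \<and> snd i \<le> 1 \<and> {fst i..snd i} \<subseteq> W \<and>
    v * (snd i - fst i) < f (snd i) - f (fst i)}"
  have CD: "0 \<le> fst i" "fst i < snd i" "snd i \<le> 1" "{fst i..snd i} \<subseteq> W"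
     "v * (snd i - fst i) < f (snd i) - f (fst i)" if "i \<in> C" for i
    using that unfolding C_def by auto
  define c where "c = (\<lambda>i. (fst i + snd i) / 2 :: real)"
  define r where "r = (\<lambda>i. (snd i - fst i) / 2 :: real)"
  have bl: "ball (c i) (r i) = {fst i<..<snd i}" for i
  proof -
    have "c i - r i = fst i" "c i + r i = snd i" by (simp_all add: c_def r_def field_simps)
    then show ?thesis by (simp add: ball_eq_greaterThanLessThan)
  qed
  obtain D where D: "countable D" "D \<subseteq> C"
     "pairwise (\<lambda>i j. disjnt (ball (c i) (r i)) (ball (c j) (r j))) D"
     "negligible (E - (\<Union>i \<in> D. ball (c i) (r i)))"
  proof (rule Vitali_covering_theorem_balls[of E C c r])
    fix x d :: real assume x: "x \<in> E" and "0 < d"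
    obtain e where e: "e > 0" "ball x e \<subseteq> W" using W x openE by blast
    have "x \<in> steep f v" "min d e > 0" using E(2) x e \<open>0<d\<close> by auto
    then obtain p q where pq: "0 \<le> p" "p < x" "x < q" "q \<le> 1" "q - p < min d e" "v * (q - p) < f q - f p"
      unfolding steep_def by blast
    then have "{p..q} \<subseteq> ball x e" by (auto simp: dist_real_def)
    then have "(p,q) \<in> C" using pq e unfolding C_def by auto
    moreover have "x \<in> ball (c (p,q)) (r (p,q))" unfolding bl using pq by simp
    moreover have "r (p,q) < d" unfolding r_def using pq by simp
    ultimately show "\<exists>i. i \<in> C \<and> x \<in> ball (c i) (r i) \<and> r i < d" by blast
  qed
  let ?F = "\<lambda>i. E \<inter> {fst i<..<snd i}"
  have m: "d \<in> lmeasurable" if "d \<in> ?F ` D" for d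
    using that E(1) by auto
  have mU: "\<Union>D' \<in> lmeasurable" if "D' \<subseteq> ?F ` D" "finite D'" for D'
    using that m by (intro fmeasurable.finite_Union) auto
  obtain D' where D': "D' \<subseteq> ?F ` D" "finite D'" "measure lebesgue (\<Union>(?F ` D)) - \<eta> < measure lebesgue (\<Union>D')"
  proof (rule measure_countable_Union_approachable[of "?F ` D" \<eta> "measure lebesgue E"])
    show "measure lebesgue (\<Union>D') \<le> measure lebesgue E" if "D' \<subseteq> ?F ` D" "finite D'" for D'
      using mU[OF that] that E(1) by (intro measure_mono_fmeasurable) auto
  qed (use D(1) m \<open>0<\<eta>\<close> in auto)
  from D'(1,2) obtain D0 where D0: "D0 \<subseteq> D" "finite D0" "D' = ?F ` D0" using finite_subset_image by meson
  define \<J> where "\<J> = (\<lambda>i. {fst i..snd i}) ` D0"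
  have JE: "\<exists>i. K = {fst i..snd i} \<and> i \<in> D0 \<and> i \<in> C" if "K \<in> \<J>" for K
    using that D0(1) D(2) unfolding \<J>_def by blast
  have inn: "{fst i<..<snd i} \<subseteq> interior (\<Union>\<J>)" if "i \<in> D0" for i
  proof (rule interior_maximal)
    have "{fst i..snd i} \<in> \<J>" using that unfolding \<J>_def by blast
    moreover have "{fst i<..<snd i} \<subseteq> {fst i..snd i}" by auto
    ultimately show "{fst i<..<snd i} \<subseteq> \<Union>\<J>" by blast
  qed auto
  show ?thesis
  proof (rule that)
    show "\<J> division_of \<Union>\<J>"
    proof (rule division_ofI)
      show "finite \<J>" unfolding \<J>_def using D0 by simp
      fix K assume K: "K \<in> \<J>"
      then obtain i where i: "K = {fst i..snd i}" "i \<in> D0" "i \<in> C" using JE by blast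
      show "K \<subseteq> \<Union>\<J>" using K by blast
      show "K \<noteq> {}" using i(1) CD(2)[OF i(3)] by simp
      show "\<exists>a b. K = cbox a b" using i(1) by (metis box_real(2))
      fix L assume L: "L \<in> \<J>" "K \<noteq> L"
      then obtain j where j: "L = {fst j..snd j}" "j \<in> D0" using JE by blast
      have "i \<noteq> j" using i j L(2) by auto
      then have "disjnt {fst i<..<snd i} {fst j<..<snd j}"
        using pairwiseD[OF D(3), of i j] D0(1) i(2) j(2) unfolding bl by blast
      then show "interior K \<inter> interior L = {}" using i j by (simp add: disjnt_def)
    qed simp
    show "\<Union>\<J> \<subseteq> W \<inter> I01"
    proof (rule Union_least)
      fix K assume "K \<in> \<J>"
      then obtain i where i: "K = {fst i..snd i}" "i \<in> D0" "i \<in> C" using JE by blast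
      then show "K \<subseteq> W \<inter> I01" using CD[OF i(3)] by auto
    qed
    show "v * (Sup K - Inf K) \<le> incr f K" if K: "K \<in> \<J>" for K
    proof -
      obtain i where i: "K = {fst i..snd i}" "i \<in> D0" "i \<in> C" using JE[OF K] by blast
      then show ?thesis using CD[OF i(3)] by simp
    qed
    have iJ: "interior (\<Union>\<J>) \<in> sets lebesgue" by simp
    have eqm: "measure lebesgue (\<Union>(?F ` D)) = measure lebesgue E"
    proof (rule measure_negligible_symdiff[OF E(1)])
      show "negligible (E - \<Union>(?F ` D) \<union> (\<Union>(?F ` D) - E))"
        by (rule negligible_subset[OF D(4)]) (auto simp: bl)
    qed
    have "measure lebesgue (E - interior (\<Union>\<J>)) \<le> measure lebesgue (E - \<Union>D')"
    proof (rule measure_mono_fmeasurable)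
      show "E - interior (\<Union>\<J>) \<subseteq> E - \<Union>D'" using inn unfolding D0(3) by blast
      show "E - interior (\<Union>\<J>) \<in> sets lebesgue" using E(1) by auto
      show "E - \<Union>D' \<in> lmeasurable" using E(1) mU[OF D'(1,2)] by (auto intro: fmeasurable_Diff)
    qed
    also have "\<dots> = measure lebesgue E - measure lebesgue (\<Union>D')"
      by (rule measurable_measure_Diff) (use E mU[OF D'(1,2)] D0(3) in auto)
    also have "\<dots> < \<eta>" using D'(3) eqm by simp
    finally show "measure lebesgue (E - interior (\<Union>\<J>)) < \<eta>" .
  qed
qed

text \<open>
  Steepness is tested on intervals with \<open>x\<close> in their interior; by continuity of \<open>f\<close> one end point
  can be moved to \<open>x\<close>.
\<close>

lemma not_steep_imp_quotient_le:
  assumes f: "continuous_on I01 f" and x: "x \<in> {0<..<1}" "x \<notin> steep f v"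
  shows "\<forall>\<^sub>F y in at x. (f y - f x) / (y - x) \<le> v"
proof -
  obtain d where d: "d > 0" "\<And>p q. \<lbrakk>0 \<le> p; p < x; x < q; q \<le> 1; q - p < d\<rbrakk> \<Longrightarrow> f q - f p \<le> v * (q - p)"
  proof -
    obtain d where d: "d > 0" "\<not> (\<exists>p q. 0 \<le> p \<and> p < x \<and> x < q \<and> q \<le> 1 \<and> q - p < d \<and> v * (q - p) < f q - f p)"
      using x(2) unfolding steep_def by blast
    show ?thesis
    proof (rule that[OF d(1)])
      fix p q assume "0 \<le> p" "p < x" "x < q" "q \<le> 1" "q - p < d"
      with d(2) have "\<not> v * (q - p) < f q - f p" by blast
      then show "f q - f p \<le> v * (q - p)" by simp
    qed
  qed
  have fx: "isCont f x"
    by (rule continuous_on_interior[OF f]) (use x in simp)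
  have up: "f y - f x \<le> v * (y - x)" if y: "x < y" "y < x + d" "y \<le> 1" for y
  proof (rule tendsto_le[of "at_left x"])
    show "((\<lambda>p. v * (y - p)) \<longlongrightarrow> v * (y - x)) (at_left x)" by (intro tendsto_intros)
    show "((\<lambda>p. f y - f p) \<longlongrightarrow> f y - f x) (at_left x)"
      using fx by (intro tendsto_intros) (simp add: isCont_def filterlim_at_split)
    have "max 0 (y - d) < x" using x y by auto
    then have "\<forall>\<^sub>F p in at_left x. p \<in> {max 0 (y - d)<..<x}" by (rule eventually_at_left_real)
    then show "\<forall>\<^sub>F p in at_left x. f y - f p \<le> v * (y - p)"
      by eventually_elim (use d y in auto)
  qed simp
  have dn: "f x - f y \<le> v * (x - y)" if y: "y < x" "x - d < y" "0 \<le> y" for y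
  proof (rule tendsto_le[of "at_right x"])
    show "((\<lambda>q. v * (q - y)) \<longlongrightarrow> v * (x - y)) (at_right x)" by (intro tendsto_intros)
    show "((\<lambda>q. f q - f y) \<longlongrightarrow> f x - f y) (at_right x)"
      using fx by (intro tendsto_intros) (simp add: isCont_def filterlim_at_split)
    have "x < min 1 (y + d)" using x y by auto
    then have "\<forall>\<^sub>F q in at_right x. q \<in> {x<..<min 1 (y + d)}" by (rule eventually_at_right_real)
    then show "\<forall>\<^sub>F q in at_right x. f q - f y \<le> v * (q - y)"
      by eventually_elim (use d y in auto)
  qed simp
  define e where "e = min d (min x (1 - x))"
  have "e > 0" using d x by (auto simp: e_def)
  moreover have "(f y - f x) / (y - x) \<le> v" if "y \<noteq> x" "dist y x < e" for y
  proof (cases "x < y")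
    case True
    then have "f y - f x \<le> v * (y - x)" using that by (intro up) (auto simp: e_def dist_real_def)
    with True show ?thesis by (simp add: pos_divide_le_eq)
  next
    case False
    then have "f x - f y \<le> v * (x - y)" using that by (intro dn) (auto simp: e_def dist_real_def)
    with False that show ?thesis by (simp add: neg_divide_le_eq algebra_simps)
  qed
  ultimately show ?thesis unfolding eventually_at by blast
qed

text \<open>
  Rational slopes suffice, so that only countably many exceptional sets have to be discarded.
\<close>

lemma has_real_derivative_of_not_steep:
  assumes f: "continuous_on I01 f" and x: "x \<in> {0<..<1}"
    and up: "\<And>v. v \<in> \<rat> \<Longrightarrow> L < v \<Longrightarrow> x \<notin> steep f v"
    and lo: "\<And>u. u \<in> \<rat> \<Longrightarrow> u < L \<Longrightarrow> x \<notin> steep (\<lambda>x. - f x) (- u)"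
  shows "(f has_real_derivative L) (at x)"
  unfolding has_field_derivative_iff
proof (rule order_tendstoI)
  fix a assume "a < L"
  then obtain u where u: "u \<in> \<rat>" "a < u" "u < L" using Rats_dense_in_real by blast
  have "continuous_on I01 (\<lambda>x. - f x)" using f by (intro continuous_intros)
  from not_steep_imp_quotient_le[OF this x lo[OF u(1,3)]]
  show "\<forall>\<^sub>F y in at x. a < (f y - f x) / (y - x)"
    by eventually_elim (use u(2) in \<open>simp add: minus_divide_left[symmetric] diff_divide_distrib\<close>)
next
  fix a assume "L < a"
  then obtain u where u: "u \<in> \<rat>" "L < u" "u < a" using Rats_dense_in_real by blast
  from not_steep_imp_quotient_le[OF f x up[OF u(1,2)]]
  show "\<forall>\<^sub>F y in at x. (f y - f x) / (y - x) < a"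
    by eventually_elim (use u(3) in simp)
qed

section \<open>Almost everywhere differentiability of absolutely continuous functions\<close>

lemma AE_leb01I:
  assumes "negligible N" "\<And>t. t \<in> {0<..<1} \<Longrightarrow> t \<notin> N \<Longrightarrow> P t"
  shows "AE t in leb01. P t"
proof -
  have "negligible (N \<union> {0,1})" using assms(1) by (intro negligible_Un) auto
  then have "N \<union> {0,1} \<in> null_sets lebesgue" by (simp add: negligible_iff_null_sets)
  then have "AE t in lebesgue. t \<in> I01 \<longrightarrow> P t"
    by (rule AE_I'[of "N \<union> {0, 1}"]) (use assms(2) in \<open>force simp: less_le\<close>)
  then show ?thesis by (subst AE_restrict_space_iff) auto
qed

lemma absolutely_continuous_onD:
  assumes "absolutely_continuous_on S f" "0 < \<epsilon>"
  obtains \<delta> where "0 < \<delta>"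
    "\<And>\<D>. \<D> division_of \<Union>\<D> \<Longrightarrow> \<Union>\<D> \<subseteq> S \<Longrightarrow> measure lebesgue (\<Union>\<D>) < \<delta> \<Longrightarrow> (\<Sum>K\<in>\<D>. \<bar>incr f K\<bar>) < \<epsilon>"
proof -
  obtain \<delta> where \<delta>: "0 < \<delta>" "\<forall>\<D>. \<D> division_of \<Union>\<D> \<and> \<Union>\<D> \<subseteq> S \<and> (\<Sum>K\<in>\<D>. Sup K - Inf K) < \<delta> \<longrightarrow>
        (\<Sum>K\<in>\<D>. \<bar>incr f K\<bar>) < \<epsilon>"
    using assms unfolding absolutely_continuous_on_def by blast
  show ?thesis
  proof (rule that[OF \<delta>(1)])
    fix \<D> assume "\<D> division_of \<Union>\<D>" "\<Union>\<D> \<subseteq> S" "measure lebesgue (\<Union>\<D>) < \<delta>"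
    then show "(\<Sum>K\<in>\<D>. \<bar>incr f K\<bar>) < \<epsilon>" using \<delta>(2) measure_division[of \<D> "\<Union>\<D>"] by simp
  qed
qed

lemma absolutely_continuous_on_imp_continuous_on:
  assumes "absolutely_continuous_on I01 f"
  shows "continuous_on I01 f"
  unfolding continuous_on_iff
proof (intro ballI allI impI)
  fix x e :: real assume x: "x \<in> I01" and "0 < e"
  obtain d where d: "0 < d"
    "\<And>\<D>. \<D> division_of \<Union>\<D> \<Longrightarrow> \<Union>\<D> \<subseteq> I01 \<Longrightarrow> measure lebesgue (\<Union>\<D>) < d \<Longrightarrow> (\<Sum>K\<in>\<D>. \<bar>incr f K\<bar>) < e"
    using absolutely_continuous_onD[OF assms \<open>0 < e\<close>] by blast
  have "dist (f y) (f x) < e" if y: "y \<in> I01" "dist y x < d" for y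
  proof -
    have "{{min x y..max x y}} division_of {min x y..max x y}"
      using division_of_self[of "min x y" "max x y"] by simp
    moreover have "{min x y..max x y} \<subseteq> I01" using x y(1) by auto
    moreover have "measure lebesgue {min x y..max x y} < d"
      using y(2) by (auto simp: dist_real_def max_def min_def)
    ultimately have "(\<Sum>K\<in>{{min x y..max x y}}. \<bar>incr f K\<bar>) < e"
      by (intro d) simp_all
    then show ?thesis by (simp add: dist_real_def min_def max_def split: if_splits)
  qed
  with d(1) show "\<exists>d>0. \<forall>y\<in>I01. dist y x < d \<longrightarrow> dist (f y) (f x) < e" by blast
qed

lemma outer_open_lmeasurable:
  fixes E :: "real set"
  assumes "E \<in> lmeasurable" "0 < e"
  obtains W where "open W" "E \<subseteq> W" "W \<in> lmeasurable" "W - E \<in> lmeasurable" "measure lebesgue (W - E) < e"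
    "measure lebesgue W < measure lebesgue E + e"
proof -
  obtain W where W: "open W" "E \<subseteq> W" "W - E \<in> lmeasurable" "emeasure lebesgue (W - E) < ennreal e"
    using sets_lebesgue_outer_open[of E e] assms by blast
  have m: "measure lebesgue (W - E) < e"
    using W(3,4) by (metis assms(2) emeasure_eq_measure2 ennreal_less_iff measure_nonneg)
  have "W = E \<union> (W - E)" using W(2) by blast
  then have Wm: "W \<in> lmeasurable" using assms(1) W(3) by (metis fmeasurable.Un)
  have "measure lebesgue (W - E) = measure lebesgue W - measure lebesgue E"
    by (rule measurable_measure_Diff) (use Wm assms W in auto)
  then show ?thesis using that[of W] W Wm m by simp
qed

text \<open>
  Suppose the set \<open>E\<close> has measure \<open>m > 0\<close>. A Vitali selection \<open>\<I>\<close> of intervals of slope at most \<open>u\<close>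
  fills \<open>E\<close>, and inside it a selection \<open>\<J>\<close> of intervals of slope at least \<open>v\<close> still fills \<open>E\<close>, both
  up to small measure and inside an open set barely larger than \<open>E\<close>. So the gaps between them are
  short and, by absolute continuity, \<open>f\<close> changes little over them. Hence \<open>f\<close> grows by at least about \<open>v * m\<close>
  over \<open>\<J>\<close> and by at most about \<open>u * m\<close> over \<open>\<I>\<close>, although the two growths nearly agree.
\<close>

lemma negligible_steep_both:
  assumes ac: "absolutely_continuous_on I01 f" and uv: "u < v"
  shows "negligible (steep f v \<inter> steep (\<lambda>x. - f x) (- u))" (is "negligible ?E")
proof (rule ccontr)
  assume "\<not> negligible ?E"
  have E: "?E \<in> lmeasurable" using steep_lmeasurable by (auto intro: fmeasurable_Int_fmeasurable)
  define m where "m = measure lebesgue ?E"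
  have m: "m > 0" using \<open>\<not> negligible ?E\<close> negligible_iff_measure0[OF E] measure_nonneg[of lebesgue ?E]
    by (simp add: m_def less_le)
  define k where "k = (v - u) * m / 4"
  have k: "k > 0" using m uv by (simp add: k_def)
  obtain d where d: "0 < d"
    "\<And>\<D>. \<D> division_of \<Union>\<D> \<Longrightarrow> \<Union>\<D> \<subseteq> I01 \<Longrightarrow> measure lebesgue (\<Union>\<D>) < d \<Longrightarrow> (\<Sum>K\<in>\<D>. \<bar>incr f K\<bar>) < k"
    using absolutely_continuous_onD[OF ac k] by blast
  \<comment> \<open>three errors of size \<open>h\<close> add up to the length of the gaps; the bounds make the growth lost
    to them, by \<open>d\<close> and by the factor \<open>u\<close>, at most \<open>2 * k\<close>, whereas the growths should differ by \<open>3 * k\<close>\<close>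
  define h where "h = min (d / 3) (min (m / 12) (k / (3 * (\<bar>u\<bar> + 1))))"
  have h: "0 < h" using d m k by (simp add: h_def)
  have h1: "3 * h \<le> d" "12 * h \<le> m" by (simp_all add: h_def min_le_iff_disj)
  have "h \<le> k / (3 * (\<bar>u\<bar> + 1))" by (simp add: h_def)
  then have h2: "3 * h * (\<bar>u\<bar> + 1) \<le> k" by (simp add: pos_le_divide_eq algebra_simps)
  obtain W where W: "open W" "?E \<subseteq> W" "W \<in> lmeasurable" "measure lebesgue W < m + h"
    using outer_open_lmeasurable[OF E h] unfolding m_def by metis
  obtain \<I> where I: "\<I> division_of \<Union>\<I>" "\<Union>\<I> \<subseteq> W \<inter> I01"
    "\<And>K. K \<in> \<I> \<Longrightarrow> (- u) * (Sup K - Inf K) \<le> incr (\<lambda>x. - f x) K"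
    "measure lebesgue (?E - interior (\<Union>\<I>)) < h"
    using Vitali_steep[OF E _ W(1,2) h, of "\<lambda>x. - f x" "- u"] by blast
  let ?E' = "?E \<inter> interior (\<Union>\<I>)"
  have E': "?E' \<in> lmeasurable" using E by (auto intro: fmeasurable_Int_fmeasurable)
  obtain \<J> where J: "\<J> division_of \<Union>\<J>" "\<Union>\<J> \<subseteq> interior (\<Union>\<I>) \<inter> I01"
    "\<And>K. K \<in> \<J> \<Longrightarrow> v * (Sup K - Inf K) \<le> incr f K"
    "measure lebesgue (?E' - interior (\<Union>\<J>)) < h"
    using Vitali_steep[OF E' _ open_interior _ h, of f v "\<Union>\<I>"] by blast
  have JI: "\<Union>\<J> \<subseteq> \<Union>\<I>" using J(2) interior_subset by blast
  obtain \<G> where G: "\<G> division_of \<Union>\<G>" "\<Union>\<G> \<subseteq> \<Union>\<I>"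
    "\<And>f. (\<Sum>K\<in>\<I>. incr f K) = (\<Sum>K\<in>\<J>. incr f K) + (\<Sum>K\<in>\<G>. incr f K)"
    using extend_division_with_gaps[OF I(1) J(1) JI] by blast
  have lm: "\<Union>\<I> \<in> lmeasurable" "\<Union>\<J> \<in> lmeasurable"
    using I(1) J(1) lmeasurable_division by blast+
  define i j g where ijg: "i = measure lebesgue (\<Union>\<I>)" "j = measure lebesgue (\<Union>\<J>)" "g = measure lebesgue (\<Union>\<G>)"
  have ieq: "i = j + g" using G(3)[of "\<lambda>x. x"] unfolding ijg
    by (simp add: measure_division[OF I(1)] measure_division[OF J(1)] measure_division[OF G(1)])
  have i: "i < m + h"
  proof -
    have "i \<le> measure lebesgue W" unfolding ijg
      by (rule measure_mono_fmeasurable) (use I(2) lm W in auto)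
    with W show ?thesis by simp
  qed
  have j: "m - 2 * h < j"
  proof -
    have "measure lebesgue ?E' = m - measure lebesgue (?E - interior (\<Union>\<I>))"
    proof -
      have "measure lebesgue (?E - interior (\<Union>\<I>)) = measure lebesgue (?E - ?E')" by (rule arg_cong[of _ _ "measure lebesgue"]) blast
      also have "\<dots> = m - measure lebesgue ?E'" unfolding m_def by (rule measurable_measure_Diff[OF E]) (use E' in auto)
      finally show ?thesis by simp
    qed
    moreover have "measure lebesgue ?E' \<le> measure lebesgue (\<Union>\<J> \<union> (?E' - interior (\<Union>\<J>)))"
    proof (rule measure_mono_fmeasurable)
      show "?E' \<subseteq> \<Union>\<J> \<union> (?E' - interior (\<Union>\<J>))" using interior_subset by blast
      show "\<Union>\<J> \<union> (?E' - interior (\<Union>\<J>)) \<in> lmeasurable"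
        using lm E' by (intro fmeasurable.Un fmeasurable_Diff) auto
    qed (use E' in auto)
    moreover have "\<dots> \<le> j + measure lebesgue (?E' - interior (\<Union>\<J>))" unfolding ijg
      by (rule measure_Un_le) (use lm E' in auto)
    ultimately show ?thesis using I(4) J(4) by simp
  qed
  have "g < d" using ieq i j h1 by simp
  then have "(\<Sum>K\<in>\<G>. \<bar>incr f K\<bar>) < k"
    using G(1) order_trans[OF G(2) order_trans[OF I(2) Int_lower2]] unfolding ijg by (intro d)
  then have "- k \<le> (\<Sum>K\<in>\<G>. incr f K)"
    using sum_abs[of "incr f" \<G>] by linarith
  moreover have "v * j \<le> (\<Sum>K\<in>\<J>. incr f K)"
    unfolding ijg measure_division[OF J(1)] sum_distrib_left by (rule sum_mono) (rule J)
  moreover have "(\<Sum>K\<in>\<I>. incr f K) \<le> u * i"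
    unfolding ijg measure_division[OF I(1)] sum_distrib_left
  proof (rule sum_mono)
    fix K assume "K \<in> \<I>" from I(3)[OF this] show "incr f K \<le> u * (Sup K - Inf K)" by simp
  qed
  ultimately have "v * j - k \<le> u * (j + g)" using G(3)[of f] ieq by simp
  moreover have "u * g \<le> k"
  proof -
    have "g \<ge> 0" unfolding ijg by simp
    have "u * g \<le> (\<bar>u\<bar> + 1) * g" using \<open>g \<ge> 0\<close> by (intro mult_right_mono) auto
    also have "\<dots> \<le> (\<bar>u\<bar> + 1) * (3 * h)" using ieq i j by (intro mult_left_mono) auto
    finally show ?thesis using h2 by (simp add: mult.commute)
  qed
  ultimately have "(v - u) * j \<le> 2 * k" by (simp add: algebra_simps)
  moreover have "(v - u) * (3 / 4 * m) \<le> (v - u) * j"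
    using j h1 uv m by (intro mult_left_mono) auto
  moreover have "(v - u) * (3 / 4 * m) = 3 * k" by (simp add: k_def)
  ultimately show False using k by linarith
qed

text \<open>
  On an interval shorter than the \<open>\<delta>\<close> belonging to \<open>\<epsilon> = 1\<close>, the increments of \<open>f\<close> over disjoint
  intervals add up to less than \<open>1\<close>, so a set on which \<open>f\<close> is steeper than \<open>n\<close> has measure at most
  about \<open>1 / n\<close> there.
\<close>

lemma negligible_infinitely_steep:
  assumes ac: "absolutely_continuous_on I01 f"
  shows "negligible (\<Inter>n::nat. steep f (real n))" (is "negligible ?N")
proof (subst locally_negligible_alt, rule ballI)
  fix x assume "x \<in> ?N"
  obtain d where d: "0 < d"
    "\<And>\<D>. \<D> division_of \<Union>\<D> \<Longrightarrow> \<Union>\<D> \<subseteq> I01 \<Longrightarrow> measure lebesgue (\<Union>\<D>) < d \<Longrightarrow> (\<Sum>K\<in>\<D>. \<bar>incr f K\<bar>) < 1"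
    using absolutely_continuous_onD[OF ac zero_less_one] by blast
  let ?B = "ball x (d / 3)"
  let ?E = "?N \<inter> ?B"
  have "?N \<in> sets lebesgue" using steep_lmeasurable by (intro sets.countable_INT) auto
  then have E: "?E \<in> lmeasurable" by (metis fmeasurable_Int_fmeasurable inf_commute lmeasurable_ball)
  have "negligible ?E"
  proof (rule ccontr)
    assume "\<not> negligible ?E"
    define m where "m = measure lebesgue ?E"
    have m: "m > 0" using \<open>\<not> negligible ?E\<close> negligible_iff_measure0[OF E] measure_nonneg[of lebesgue ?E]
      by (simp add: m_def less_le)
    obtain n where n: "2 / m < real n" using reals_Archimedean2 by blast
    obtain \<J> where J: "\<J> division_of \<Union>\<J>" "\<Union>\<J> \<subseteq> ?B \<inter> I01"
      "\<And>K. K \<in> \<J> \<Longrightarrow> n * (Sup K - Inf K) \<le> incr f K"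
      "measure lebesgue (?E - interior (\<Union>\<J>)) < m / 2"
    proof (rule Vitali_steep[OF E _ open_ball, of f "real n" x "d / 3" "m / 2"])
      show "?E \<subseteq> steep f (real n)" "?E \<subseteq> ?B" "0 < m / 2" using m by auto
    qed blast
    define j where "j = measure lebesgue (\<Union>\<J>)"
    have lm: "\<Union>\<J> \<in> lmeasurable" using J(1) lmeasurable_division by blast
    have "m \<le> measure lebesgue (\<Union>\<J> \<union> (?E - interior (\<Union>\<J>)))" unfolding m_def
    proof (rule measure_mono_fmeasurable)
      show "?E \<subseteq> \<Union>\<J> \<union> (?E - interior (\<Union>\<J>))" using interior_subset by blast
      show "\<Union>\<J> \<union> (?E - interior (\<Union>\<J>)) \<in> lmeasurable"
        using lm E by (intro fmeasurable.Un fmeasurable_Diff) auto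
    qed (use E in auto)
    also have "\<dots> \<le> j + measure lebesgue (?E - interior (\<Union>\<J>))" unfolding j_def
      by (rule measure_Un_le) (use lm E in auto)
    finally have j: "m / 2 < j" using J(4) by simp
    have "j \<le> measure lebesgue ?B" unfolding j_def
      by (rule measure_mono_fmeasurable) (use J(2) lm in auto)
    also have "\<dots> < d" using d(1) by (simp add: ball_eq_greaterThanLessThan)
    finally have "(\<Sum>K\<in>\<J>. \<bar>incr f K\<bar>) < 1" using J(1,2) unfolding j_def by (intro d) auto
    moreover have "n * j \<le> (\<Sum>K\<in>\<J>. incr f K)"
      unfolding j_def measure_division[OF J(1)] sum_distrib_left by (rule sum_mono) (rule J)
    ultimately have "n * j < 1" using sum_abs[of "incr f" \<J>] by linarith
    moreover have "n * (m / 2) \<le> n * j" using j by (intro mult_left_mono) auto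
    moreover have "1 < n * (m / 2)" using n m by (simp add: divide_less_eq)
    ultimately show False by simp
  qed
  then show "\<exists>U. openin (top_of_set ?N) U \<and> x \<in> U \<and> negligible U"
    using \<open>x \<in> ?N\<close> d(1) by (intro exI[of _ ?E]) (auto simp: openin_open_Int)
qed

lemma absolutely_continuous_on_uminus:
  assumes "absolutely_continuous_on S f"
  shows "absolutely_continuous_on S (\<lambda>x. - f x)"
proof -
  have eq: "\<bar>- a - - b\<bar> = \<bar>a - b\<bar>" for a b :: real by simp
  show ?thesis using assms unfolding absolutely_continuous_on_def eq .
qed

text \<open>
  Let \<open>t\<close> avoid the null sets above, for all rational slopes. Then no \<open>v\<close> at which \<open>f\<close> is steep
  exceeds a \<open>u\<close> for which \<open>- f\<close> is steep at slope \<open>- u\<close>. The infimum of the slopes at which \<open>f\<close> is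
  not steep is therefore the derivative; it is finite because neither \<open>f\<close> nor \<open>- f\<close> is infinitely
  steep at \<open>t\<close>.
\<close>

lemma absolutely_continuous_on_differentiable_AE:
  assumes ac: "absolutely_continuous_on I01 f"
  shows "AE t in leb01. f differentiable (at t)"
proof (rule AE_leb01I)
  let ?N = "\<lambda>f::real\<Rightarrow>real. (\<Inter>n::nat. steep f (real n))"
  let ?M = "\<Union>(u, v)\<in>{(u, v). u \<in> \<rat> \<and> v \<in> \<rat> \<and> u < v}. steep f v \<inter> steep (\<lambda>x. - f x) (- u)"
  have ac': "absolutely_continuous_on I01 (\<lambda>x. - f x)" by (rule absolutely_continuous_on_uminus[OF ac])
  have "countable {(u::real, v::real). u \<in> \<rat> \<and> v \<in> \<rat> \<and> u < v}"
    by (rule countable_subset[of _ "\<rat> \<times> \<rat>"]) (auto intro: countable_rat)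
  then have "negligible ?M"
    using negligible_steep_both[OF ac] by (intro negligible_countable_Union) (auto intro: countable_image)
  then show "negligible (?N f \<union> ?N (\<lambda>x. - f x) \<union> ?M)"
    using negligible_infinitely_steep[OF ac] negligible_infinitely_steep[OF ac'] by (intro negligible_Un)
  fix t :: real assume t: "t \<in> {0<..<1}" and n: "t \<notin> ?N f \<union> ?N (\<lambda>x. - f x) \<union> ?M"
  have uv: "v \<le> u" if "v \<in> \<rat>" "u \<in> \<rat>" "t \<in> steep f v" "t \<in> steep (\<lambda>x. - f x) (- u)" for u v
    using n that by (force simp: not_le)
  have fc: "continuous_on I01 f" by (rule absolutely_continuous_on_imp_continuous_on[OF ac])
  have fc': "continuous_on I01 (\<lambda>x. - f x)" by (rule absolutely_continuous_on_imp_continuous_on[OF ac'])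
  let ?V = "{v \<in> \<rat>. t \<notin> steep f v}"
  obtain n0 n1 :: nat where n01: "t \<notin> steep f (real n0)" "t \<notin> steep (\<lambda>x. - f x) (real n1)" using n by auto
  have ne: "?V \<noteq> {}" using n01(1) Rats_of_nat by blast
  have lb: "- real n1 \<le> v" if "v \<in> ?V" for v
  proof -
    have "\<forall>\<^sub>F y in at t. (f y - f t) / (y - t) \<le> v" using that by (intro not_steep_imp_quotient_le[OF fc t]) auto
    moreover have "\<forall>\<^sub>F y in at t. (- f y - - f t) / (y - t) \<le> real n1" by (intro not_steep_imp_quotient_le[OF fc' t] n01)
    ultimately have "\<forall>\<^sub>F y in at t. - real n1 \<le> v"
      by eventually_elim (simp add: minus_divide_left[symmetric] diff_divide_distrib)
    then show ?thesis by simp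
  qed
  then have bb: "bdd_below ?V" by (meson bdd_belowI)
  have "(f has_real_derivative Inf ?V) (at t)"
  proof (rule has_real_derivative_of_not_steep[OF fc t])
    fix v :: real assume v: "v \<in> \<rat>" "Inf ?V < v"
    then obtain w where w: "w \<in> ?V" "w < v" using cInf_lessD[OF ne] by blast
    \<comment> \<open>being steep is antitone in the slope\<close>
    have "\<forall>p q. p \<le> q \<longrightarrow> w * (q - p) \<le> v * (q - p)" using w(2) by (auto intro: mult_right_mono)
    then have "steep f v \<subseteq> steep f w" unfolding steep_def by (smt (verit) Collect_mono)
    with w(1) show "t \<notin> steep f v" by blast
  next
    fix u :: real assume u: "u \<in> \<rat>" "u < Inf ?V"
    then obtain v where v: "v \<in> \<rat>" "u < v" "v < Inf ?V" using Rats_dense_in_real by blast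
    then have "t \<in> steep f v" using cInf_lower[OF _ bb, of v] by force
    with uv[OF v(1) u(1)] v(2) show "t \<notin> steep (\<lambda>x. - f x) (- u)" by linarith
  qed
  then show "f differentiable (at t)" using real_differentiable_def by blast
qed

section \<open>Lebesgue's differentiation theorem on the unit interval\<close>

lemma integrable_bounded_mult:
  fixes g b :: "real \<Rightarrow> real"
  assumes g: "integrable leb01 g" and b: "b \<in> borel_measurable leb01" "\<And>s. s \<in> I01 \<Longrightarrow> \<bar>b s\<bar> \<le> B"
  shows "integrable leb01 (\<lambda>s. b s * g s)"
proof (rule Bochner_Integration.integrable_bound)
  show "integrable leb01 (\<lambda>s. B * \<bar>g s\<bar>)" using g by simp
  show "(\<lambda>s. b s * g s) \<in> borel_measurable leb01" using g b(1) by measurable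
  have "norm (b s * g s) \<le> norm (B * \<bar>g s\<bar>)" if s: "s \<in> I01" for s
  proof -
    have "\<bar>b s\<bar> * \<bar>g s\<bar> \<le> \<bar>B\<bar> * \<bar>g s\<bar>" using b(2)[OF s] by (intro mult_right_mono) auto
    then show ?thesis by (simp add: abs_mult)
  qed
  then show "AE s in leb01. norm (b s * g s) \<le> norm (B * \<bar>g s\<bar>)" by (intro AE_I2) simp
qed

lemma integrable_indicator_mult:
  fixes g :: "real \<Rightarrow> real"
  assumes "integrable leb01 g" "A \<in> sets lebesgue"
  shows "integrable leb01 (\<lambda>s. indicator A s * g s)"
proof (rule integrable_bounded_mult[OF assms(1), where B = 1])
  show "indicat_real A \<in> borel_measurable leb01"
    by (rule measurable_restrict_space1) (use assms(2) in simp)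
qed (simp add: indicator_def)

lemma integrable_continuous_mult:
  assumes g: "integrable leb01 g" and b: "continuous_on I01 b"
  shows "integrable leb01 (\<lambda>s. b s * g s :: real)"
proof -
  have "bounded (b ` I01)" by (intro compact_imp_bounded compact_continuous_image b) simp
  then obtain B where "\<forall>x\<in>b ` I01. \<bar>x\<bar> \<le> B" unfolding bounded_real by blast
  then have "\<And>s. s \<in> I01 \<Longrightarrow> \<bar>b s\<bar> \<le> B" by blast
  moreover have "b \<in> borel_measurable leb01"
    by (rule continuous_imp_measurable_on_sets_lebesgue[OF b]) simp
  ultimately show ?thesis using integrable_bounded_mult[OF g] by blast
qed

lemma measure_leb01: "A \<subseteq> I01 \<Longrightarrow> measure leb01 A = measure lebesgue A"
  by (simp add: measure_restrict_space)

lemma finite_measure_leb01: "finite_measure leb01"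
  by (rule finite_measure_lebesgue_on) simp

lemma integrable_const_leb01: "integrable leb01 (\<lambda>s. c :: real)"
  using finite_measure_leb01 by (simp add: finite_measure.integrable_const)

lemma integral_indicator_leb01_le:
  assumes "A \<in> lmeasurable" "0 \<le> c"
  shows "(LINT s|leb01. indicator A s * c) \<le> c * measure lebesgue A"
proof -
  have "(LINT s|leb01. indicator A s * c) = c * measure leb01 (A \<inter> I01)" by simp
  also have "measure leb01 (A \<inter> I01) = measure lebesgue (A \<inter> I01)" by (rule measure_leb01) simp
  also have "c * measure lebesgue (A \<inter> I01) \<le> c * measure lebesgue A"
    using assms by (intro mult_left_mono measure_mono_fmeasurable) auto
  finally show ?thesis .
qed

text \<open>
  Split off the part of \<open>g\<close> above a high level, whose integral is small by dominated convergence;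
  the rest is bounded.
\<close>

lemma integral_small_on_small_sets:
  fixes g :: "real \<Rightarrow> real"
  assumes g: "integrable leb01 g" and "0 < \<epsilon>"
  obtains \<delta> where "0 < \<delta>"
    "\<And>A. A \<in> lmeasurable \<Longrightarrow> measure lebesgue A < \<delta> \<Longrightarrow> (LINT s|leb01. indicator A s * \<bar>g s\<bar>) < \<epsilon>"
proof -
  let ?T = "\<lambda>n::nat. \<lambda>s. if real n < \<bar>g s\<bar> then \<bar>g s\<bar> else 0"
  have gm [measurable]: "g \<in> borel_measurable leb01" using g by simp
  have Ti: "integrable leb01 (?T n)" for n
    by (rule Bochner_Integration.integrable_bound[OF g]) auto
  have "(\<lambda>n. LINT s|leb01. ?T n s) \<longlonglongrightarrow> (LINT s|leb01. 0)"
  proof (rule integral_dominated_convergence[where w = "\<lambda>s. \<bar>g s\<bar>"])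
    show "AE s in leb01. (\<lambda>n. ?T n s) \<longlonglongrightarrow> 0"
    proof (rule AE_I2, rule tendsto_eventually)
      fix s
      obtain N where "\<bar>g s\<bar> < real N" using reals_Archimedean2 by blast
      then show "\<forall>\<^sub>F n in sequentially. ?T n s = 0"
        by (intro eventually_sequentiallyI[of N]) auto
    qed
  qed (use g in auto)
  then have "\<forall>\<^sub>F n in sequentially. (LINT s|leb01. ?T n s) < \<epsilon> / 2"
    by (rule order_tendstoD) (use \<open>0 < \<epsilon>\<close> in simp)
  then obtain n where n: "(LINT s|leb01. ?T n s) < \<epsilon> / 2" by (auto simp: eventually_sequentially)
  show ?thesis
  proof (rule that)
    show "0 < \<epsilon> / (2 * (real n + 1))" using \<open>0 < \<epsilon>\<close> by simp
    fix A :: "real set" assume A: "A \<in> lmeasurable" "measure lebesgue A < \<epsilon> / (2 * (real n + 1))"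
    have iA: "integrable leb01 (\<lambda>s. indicator A s * (real n))"
      using A(1) by (intro integrable_indicator_mult integrable_const_leb01) auto
    have "(LINT s|leb01. indicator A s * \<bar>g s\<bar>) \<le> (LINT s|leb01. indicator A s * real n + ?T n s)"
    proof (rule integral_mono)
      show "integrable leb01 (\<lambda>s. indicator A s * \<bar>g s\<bar>)"
        using A(1) g by (intro integrable_indicator_mult) auto
      show "integrable leb01 (\<lambda>s. indicator A s * real n + ?T n s)" using iA Ti by (rule Bochner_Integration.integrable_add)
    qed (simp add: indicator_def)
    also have "\<dots> = (LINT s|leb01. indicator A s * real n) + (LINT s|leb01. ?T n s)"
      using iA Ti by (rule Bochner_Integration.integral_add)
    also have "(LINT s|leb01. indicator A s * real n) \<le> real n * measure lebesgue A"
      using A(1) by (intro integral_indicator_leb01_le) auto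
    also have "real n * measure lebesgue A \<le> (real n + 1) * measure lebesgue A"
      by (intro mult_right_mono) auto
    also have "(real n + 1) * measure lebesgue A < \<epsilon> / 2"
      using A(2) by (simp add: field_simps)
    finally show "(LINT s|leb01. indicator A s * \<bar>g s\<bar>) < \<epsilon>" using n by simp
  qed
qed

definition primitive :: "(real \<Rightarrow> real) \<Rightarrow> real \<Rightarrow> real" where
  "primitive g t = (LINT s|leb01. indicator {0..t} s * g s)"

lemma primitive_0:
  assumes "integrable leb01 g"
  shows "primitive g 0 = 0"
proof -
  have "(LINT s|leb01. indicator {0..0} s * g s) = (LINT s|leb01. 0)"
  proof (rule integral_cong_AE)
    show "AE s in leb01. indicator {0..0} s * g s = 0"
      by (rule AE_leb01I[of "{}"]) auto
    show "(\<lambda>s. indicator {0..0} s * g s) \<in> borel_measurable leb01"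
      using integrable_indicator_mult[OF assms, of "{0..0}"] by simp
  qed simp
  then show ?thesis by (simp add: primitive_def)
qed

lemma primitive_1: "primitive g 1 = (LINT s|leb01. g s)"
  unfolding primitive_def by (rule Bochner_Integration.integral_cong) auto

lemma primitive_uminus: "primitive (\<lambda>s. - g s) = (\<lambda>t. - primitive g t)"
  by (simp add: primitive_def fun_eq_iff)

lemma primitive_diff:
  assumes g: "integrable leb01 g" and "0 \<le> p" "p \<le> q"
  shows "primitive g q - primitive g p = (LINT s|leb01. indicator {p<..q} s * g s)"
proof -
  have "(LINT s|leb01. indicator {p<..q} s * g s) = (LINT s|leb01. indicator {0..q} s * g s - indicator {0..p} s * g s)"
    by (rule Bochner_Integration.integral_cong) (use assms(2,3) in \<open>auto simp: indicator_def\<close>)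
  also have "\<dots> = primitive g q - primitive g p"
    unfolding primitive_def
    by (intro Bochner_Integration.integral_diff integrable_indicator_mult g) auto
  finally show ?thesis by simp
qed

text \<open>
  Making the intervals of a division half-open makes them disjoint without changing lengths or
  integrals, so that sums of increments of a primitive become one integral over a set.
\<close>

lemma half_open_division:
  fixes \<D> :: "real set set"
  assumes g: "integrable leb01 g" and D: "\<D> division_of \<Union>\<D>" "\<Union>\<D> \<subseteq> I01"
  obtains H where "H \<in> lmeasurable" "H \<subseteq> \<Union>\<D>" "measure lebesgue H = measure lebesgue (\<Union>\<D>)"
    "(\<Sum>K\<in>\<D>. incr (primitive g) K) = (LINT s|leb01. indicator H s * g s)"
    "(\<Sum>K\<in>\<D>. \<bar>incr (primitive g) K\<bar>) \<le> (LINT s|leb01. indicator H s * \<bar>g s\<bar>)"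
proof -
  let ?h = "\<lambda>K::real set. {Inf K<..Sup K}"
  define H where "H = (\<Union>K\<in>\<D>. ?h K)"
  note fin = division_ofD(1)[OF D(1)] and iv = interval_of_division[OF D(1)]
  have K01: "0 \<le> Inf K" "Sup K \<le> 1" if K: "K \<in> \<D>" for K
  proof -
    have "{Inf K..Sup K} \<subseteq> I01" using iv(1)[OF K] K D(2) by blast
    then show "0 \<le> Inf K" "Sup K \<le> 1" using iv(2)[OF K] by auto
  qed
  have dis: "?h K \<inter> ?h L = {}" if KL: "K \<in> \<D>" "L \<in> \<D>" "K \<noteq> L" for K L
  proof (rule ccontr)
    assume "?h K \<inter> ?h L \<noteq> {}"
    then obtain s where "s \<in> ?h K" "s \<in> ?h L" by blast
    then have s: "Inf K < s" "s \<le> Sup K" "Inf L < s" "s \<le> Sup L" by simp_all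
    have "{Inf K<..<Sup K} \<inter> {Inf L<..<Sup L} = {}"
      using division_ofD(5)[OF D(1) KL] iv(1)[OF KL(1)] iv(1)[OF KL(2)] by (metis interior_atLeastAtMost_real)
    moreover have "(max (Inf K) (Inf L) + s) / 2 \<in> {Inf K<..<Sup K} \<inter> {Inf L<..<Sup L}"
      using s by (auto simp: max_def)
    ultimately show False by blast
  qed
  have ind: "indicator H s = (\<Sum>K\<in>\<D>. indicator (?h K) s :: real)" for s
    unfolding H_def by (rule indicator_UN_disjoint[OF fin]) (use dis in \<open>auto simp: disjoint_family_on_def\<close>)
  have ii: "integrable leb01 (\<lambda>s. indicator (?h K) s * g s)" if "integrable leb01 g" for g :: "real \<Rightarrow> real" and K
    using that by (intro integrable_indicator_mult) auto
  have sum: "(LINT s|leb01. indicator H s * g s) = (\<Sum>K\<in>\<D>. LINT s|leb01. indicator (?h K) s * g s)"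
    if "integrable leb01 g" for g :: "real \<Rightarrow> real"
    unfolding ind sum_distrib_right by (rule Bochner_Integration.integral_sum) (use ii[OF that] in blast)
  show ?thesis
  proof (rule that[of H])
    have h: "?h K \<in> lmeasurable" for K
      by (rule bounded_set_imp_lmeasurable) (auto intro: bounded_subset[OF bounded_closed_interval[of "Inf K" "Sup K"]])
    show "H \<in> lmeasurable" unfolding H_def using fin h by (intro fmeasurable.finite_UN) auto
    show "H \<subseteq> \<Union>\<D>"
    proof
      fix s assume "s \<in> H"
      then obtain K where K: "K \<in> \<D>" "s \<in> ?h K" unfolding H_def by blast
      then have "s \<in> {Inf K..Sup K}" by simp
      then show "s \<in> \<Union>\<D>" using iv(1)[OF K(1)] K(1) by blast
    qed
    have "measure lebesgue H = (\<Sum>K\<in>\<D>. measure lebesgue (?h K))"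
      unfolding H_def by (rule measure_UNION'[OF fin h]) (use dis in \<open>auto simp: pairwise_def disjnt_def\<close>)
    also have "\<dots> = (\<Sum>K\<in>\<D>. Sup K - Inf K)" by (rule sum.cong) (use iv(2) in \<open>auto simp: measure_def\<close>)
    finally show "measure lebesgue H = measure lebesgue (\<Union>\<D>)" by (simp add: measure_division[OF D(1)])
    have K: "incr (primitive g) K = (LINT s|leb01. indicator (?h K) s * g s)" if "K \<in> \<D>" for K
      by (rule primitive_diff[OF g K01(1)[OF that] iv(2)[OF that]])
    show "(\<Sum>K\<in>\<D>. incr (primitive g) K) = (LINT s|leb01. indicator H s * g s)"
      unfolding sum[OF g] by (rule sum.cong) (use K in auto)
    have g': "integrable leb01 (\<lambda>s. \<bar>g s\<bar>)" using g by simp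
    show "(\<Sum>K\<in>\<D>. \<bar>incr (primitive g) K\<bar>) \<le> (LINT s|leb01. indicator H s * \<bar>g s\<bar>)"
      unfolding sum[OF g']
    proof (rule sum_mono)
      fix K assume KD: "K \<in> \<D>"
      have "\<bar>LINT s|leb01. indicator (?h K) s * g s\<bar> \<le> (LINT s|leb01. \<bar>indicator (?h K) s * g s\<bar>)"
        by (rule integral_abs_bound)
      then show "\<bar>incr (primitive g) K\<bar> \<le> (LINT s|leb01. indicator (?h K) s * \<bar>g s\<bar>)"
        unfolding K[OF KD] by (simp add: abs_mult)
    qed
  qed
qed

lemma absolutely_continuous_on_primitive:
  assumes g: "integrable leb01 g"
  shows "absolutely_continuous_on I01 (primitive g)"
  unfolding absolutely_continuous_on_def
proof (intro allI impI)
  fix \<epsilon> :: real assume "0 < \<epsilon>"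
  obtain \<delta> where \<delta>: "0 < \<delta>"
    "\<And>A. A \<in> lmeasurable \<Longrightarrow> measure lebesgue A < \<delta> \<Longrightarrow> (LINT s|leb01. indicator A s * \<bar>g s\<bar>) < \<epsilon>"
    using integral_small_on_small_sets[OF g \<open>0 < \<epsilon>\<close>] by blast
  have "(\<Sum>K\<in>\<D>. \<bar>incr (primitive g) K\<bar>) < \<epsilon>"
    if \<D>: "\<D> division_of \<Union>\<D>" "\<Union>\<D> \<subseteq> I01" "(\<Sum>K\<in>\<D>. Sup K - Inf K) < \<delta>" for \<D>
  proof -
    obtain H where H: "H \<in> lmeasurable" "H \<subseteq> \<Union>\<D>" "measure lebesgue H = measure lebesgue (\<Union>\<D>)"
      "(\<Sum>K\<in>\<D>. incr (primitive g) K) = (LINT s|leb01. indicator H s * g s)"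
      "(\<Sum>K\<in>\<D>. \<bar>incr (primitive g) K\<bar>) \<le> (LINT s|leb01. indicator H s * \<bar>g s\<bar>)"
      by (rule half_open_division[OF g \<D>(1,2)])
    have "measure lebesgue H < \<delta>" using H(3) \<D>(3) measure_division[OF \<D>(1)] by simp
    from \<delta>(2)[OF H(1) this] H(5) show ?thesis by simp
  qed
  with \<delta>(1) show "\<exists>\<delta>>0. \<forall>\<D>. \<D> division_of \<Union>\<D> \<and> \<Union>\<D> \<subseteq> I01 \<and> (\<Sum>K\<in>\<D>. Sup K - Inf K) < \<delta> \<longrightarrow>
        (\<Sum>K\<in>\<D>. \<bar>incr (primitive g) K\<bar>) < \<epsilon>" by blast
qed

text \<open>
  Let \<open>E\<close> be the set and \<open>W\<close> an open set barely larger than \<open>E\<close>. Intervals in \<open>W\<close> of slope at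
  least \<open>v\<close> that almost fill \<open>E\<close> force the integral of \<open>g\<close> over their union to be at least \<open>v\<close> times
  its measure; but \<open>g < u\<close> on \<open>E\<close> and \<open>W - E\<close> contributes next to nothing, by
  \<open>integral_small_on_small_sets\<close> applied to \<open>g - u\<close>.
\<close>

lemma negligible_primitive_steeper_than_density:
  assumes g: "integrable leb01 g" and uv: "u < v"
  shows "negligible (steep (primitive g) v \<inter> {x. g x < u})" (is "negligible ?E")
proof (rule ccontr)
  assume "\<not> negligible ?E"
  have gm [measurable]: "g \<in> borel_measurable leb01" using g by simp
  have "{x \<in> space leb01. g x < u} \<in> sets leb01" by measurable
  then have "{x \<in> I01. g x < u} \<in> sets lebesgue" by (simp add: sets_restrict_space_iff)
  moreover have "?E = steep (primitive g) v \<inter> {x \<in> I01. g x < u}" using steep_subset by fastforce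
  ultimately have E: "?E \<in> lmeasurable" using steep_lmeasurable by (simp add: fmeasurable_Int_fmeasurable)
  define m where "m = measure lebesgue ?E"
  have m: "m > 0" using \<open>\<not> negligible ?E\<close> negligible_iff_measure0[OF E] measure_nonneg[of lebesgue ?E]
    by (simp add: m_def less_le)
  define k where "k = (v - u) * m / 4"
  have k: "k > 0" using m uv by (simp add: k_def)
  obtain d where d: "0 < d"
    "\<And>A. A \<in> lmeasurable \<Longrightarrow> measure lebesgue A < d \<Longrightarrow> (LINT s|leb01. indicator A s * \<bar>g s - u\<bar>) < k"
    using integral_small_on_small_sets[OF Bochner_Integration.integrable_diff[OF g integrable_const_leb01] k] by blast
  define h where "h = min d (m / 4)"
  have h: "0 < h" "h \<le> d" "h \<le> m / 4" using d m by (auto simp: h_def)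
  obtain W where W: "open W" "?E \<subseteq> W" "W - ?E \<in> lmeasurable" "measure lebesgue (W - ?E) < h"
    using outer_open_lmeasurable[OF E h(1)] by metis
  obtain \<J> where J: "\<J> division_of \<Union>\<J>" "\<Union>\<J> \<subseteq> W \<inter> I01"
    "\<And>K. K \<in> \<J> \<Longrightarrow> v * (Sup K - Inf K) \<le> incr (primitive g) K"
    "measure lebesgue (?E - interior (\<Union>\<J>)) < h"
    using Vitali_steep[OF E _ W(1,2) h(1), of "primitive g" v] by blast
  have J01: "\<Union>\<J> \<subseteq> I01" using J(2) by blast
  obtain H where H: "H \<in> lmeasurable" "H \<subseteq> \<Union>\<J>" "measure lebesgue H = measure lebesgue (\<Union>\<J>)"
    "(\<Sum>K\<in>\<J>. incr (primitive g) K) = (LINT s|leb01. indicator H s * g s)"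
    "(\<Sum>K\<in>\<J>. \<bar>incr (primitive g) K\<bar>) \<le> (LINT s|leb01. indicator H s * \<bar>g s\<bar>)"
    by (rule half_open_division[OF g J(1) J01])
  have H01: "H \<subseteq> I01" using H(2) J01 by blast
  have lm: "\<Union>\<J> \<in> lmeasurable" using J(1) lmeasurable_division by blast
  define j where "j = measure lebesgue H"
  have j: "3 / 4 * m < j"
  proof -
    have "m \<le> measure lebesgue (\<Union>\<J> \<union> (?E - interior (\<Union>\<J>)))" unfolding m_def
    proof (rule measure_mono_fmeasurable)
      show "?E \<subseteq> \<Union>\<J> \<union> (?E - interior (\<Union>\<J>))" using interior_subset by blast
      show "\<Union>\<J> \<union> (?E - interior (\<Union>\<J>)) \<in> lmeasurable"
        using lm E by (intro fmeasurable.Un fmeasurable_Diff) auto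
    qed (use E in auto)
    also have "\<dots> \<le> measure lebesgue (\<Union>\<J>) + measure lebesgue (?E - interior (\<Union>\<J>))"
      by (rule measure_Un_le) (use lm E in auto)
    finally show ?thesis using J(4) h H(3) unfolding j_def by simp
  qed
  have iH: "integrable leb01 (\<lambda>s. indicator H s * f s)" if "integrable leb01 f" for f :: "real \<Rightarrow> real"
    using that H(1) by (intro integrable_indicator_mult) auto
  have "v * j \<le> (\<Sum>K\<in>\<J>. incr (primitive g) K)"
    unfolding j_def H(3) measure_division[OF J(1)] sum_distrib_left by (rule sum_mono) (rule J)
  also have "\<dots> \<le> (LINT s|leb01. indicator H s * u + indicator (W - ?E) s * \<bar>g s - u\<bar>)"
    unfolding H(4)
  proof (rule integral_mono)
    show "integrable leb01 (\<lambda>s. indicator H s * u + indicator (W - ?E) s * \<bar>g s - u\<bar>)"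
      using W(3) g by (intro Bochner_Integration.integrable_add iH integrable_const_leb01 integrable_indicator_mult
        integrable_abs Bochner_Integration.integrable_diff) auto
    fix s
    show "indicator H s * g s \<le> indicator H s * u + indicator (W - ?E) s * \<bar>g s - u\<bar>"
      using H(2) J(2) by (cases "s \<in> ?E") (auto simp: indicator_def)
  qed (rule iH[OF g])
  also have "\<dots> = (LINT s|leb01. indicator H s * u) + (LINT s|leb01. indicator (W - ?E) s * \<bar>g s - u\<bar>)"
    using W(3) g by (intro Bochner_Integration.integral_add iH integrable_const_leb01 integrable_indicator_mult
        integrable_abs Bochner_Integration.integrable_diff) auto
  also have "(LINT s|leb01. indicator H s * u) = u * j"
    using H01 unfolding j_def by (simp add: measure_leb01 Int_absorb2)
  finally have "v * j < u * j + k"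
    using d(2)[OF W(3)] W(4) h by simp
  then have "(v - u) * j < k" by (simp add: algebra_simps)
  moreover have "(v - u) * (3 / 4 * m) \<le> (v - u) * j" using j uv by (intro mult_left_mono) auto
  moreover have "(v - u) * (3 / 4 * m) = 3 * k" by (simp add: k_def)
  ultimately show False using k by linarith
qed

text \<open>
  Lebesgue's differentiation theorem on the line. The bound from below is the bound from above
  for \<open>- g\<close>.
\<close>

lemma primitive_has_derivative_AE:
  assumes g: "integrable leb01 g"
  shows "AE t in leb01. (primitive g has_real_derivative g t) (at t)"
proof (rule AE_leb01I)
  let ?R = "{(u::real, v::real). u \<in> \<rat> \<and> v \<in> \<rat> \<and> u < v}"
  let ?M = "\<lambda>g. \<Union>(u, v)\<in>?R. steep (primitive g) v \<inter> {x. g x < u}"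
  have g': "integrable leb01 (\<lambda>s. - g s)" using g by simp
  have R: "countable ?R"
    by (rule countable_subset[of _ "\<rat> \<times> \<rat>"]) (auto intro: countable_rat)
  have M: "negligible (?M g)" if "integrable leb01 g" for g
    using negligible_primitive_steeper_than_density[OF that] R
    by (intro negligible_countable_Union) (auto intro: countable_image)
  show "negligible (?M g \<union> ?M (\<lambda>s. - g s))"
    by (intro negligible_Un M g g')
  fix t :: real assume t: "t \<in> {0<..<1}" and n: "t \<notin> ?M g \<union> ?M (\<lambda>s. - g s)"
  have *: "t \<notin> steep (primitive f) v" if f: "t \<notin> ?M f" and v: "v \<in> \<rat>" "f t < v" for f v
  proof
    assume st: "t \<in> steep (primitive f) v"
    obtain u where "u \<in> \<rat>" "f t < u" "u < v" using v(2) Rats_dense_in_real by blast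
    with f v(1) st show False by blast
  qed
  show "(primitive g has_real_derivative g t) (at t)"
  proof (rule has_real_derivative_of_not_steep[OF _ t])
    show "continuous_on I01 (primitive g)"
      by (intro absolutely_continuous_on_imp_continuous_on absolutely_continuous_on_primitive g)
    show "t \<notin> steep (primitive g) v" if "v \<in> \<rat>" "g t < v" for v
      using *[of g v] n that by blast
    show "t \<notin> steep (\<lambda>x. - primitive g x) (- u)" if "u \<in> \<rat>" "u < g t" for u
      using *[of "\<lambda>s. - g s" "- u"] n that by (simp add: primitive_uminus)
  qed
qed

section \<open>The space of functions with absolutely continuous derivative\<close>

definition second_primitive :: "(real \<Rightarrow> real) \<Rightarrow> real \<Rightarrow> real" where
  "second_primitive g t = (LINT s|leb01. max 0 (t - s) * g s)"

lemma second_primitive_0: "second_primitive g 0 = 0"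
proof -
  have "second_primitive g 0 = (LINT s|leb01. 0)"
    unfolding second_primitive_def by (rule Bochner_Integration.integral_cong) auto
  then show ?thesis by simp
qed

lemma integrable_max_mult:
  assumes "integrable leb01 g"
  shows "integrable leb01 (\<lambda>s. max 0 (t - s) * g s)"
  by (intro integrable_continuous_mult[OF assms] continuous_intros)

lemma AE_leb01_in_I01:
  assumes "AE t in leb01. t \<in> I01 \<longrightarrow> P t"
  shows "AE t in leb01. P t"
  using assms AE_space[of leb01] by eventually_elim simp

text \<open>
  The kernel \<open>max 0 (y - s)\<close> differs from its linearisation in \<open>y\<close> at \<open>t\<close> by at most \<open>\<bar>y - t\<bar>\<close>
  if \<open>s\<close> lies between \<open>t\<close> and \<open>y\<close>, and agrees with it for all other \<open>s\<close>; the integral of \<open>\<bar>g\<bar>\<close>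
  over the short interval between \<open>t\<close> and \<open>y\<close> is small.
\<close>

lemma second_primitive_has_derivative:
  assumes g: "integrable leb01 g" and t: "t \<in> I01"
  shows "(second_primitive g has_real_derivative primitive g t) (at t within I01)"
  unfolding has_field_derivative_iff tendsto_iff
proof (intro allI impI)
  fix e :: real assume "0 < e"
  obtain d where d: "0 < d"
    "\<And>A. A \<in> lmeasurable \<Longrightarrow> measure lebesgue A < d \<Longrightarrow> (LINT s|leb01. indicator A s * \<bar>g s\<bar>) < e"
    using integral_small_on_small_sets[OF g \<open>0 < e\<close>] by blast
  have "dist ((second_primitive g y - second_primitive g t) / (y - t)) (primitive g t) < e"
    if y: "y \<in> I01" "y \<noteq> t" "dist y t < d" for y
  proof -
    let ?A = "{min t y..max t y}"
    let ?k = "\<lambda>s. max 0 (y - s) - max 0 (t - s) - (y - t) * indicator {0..t} s"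
    have iA: "integrable leb01 (\<lambda>s. indicator ?A s * \<bar>g s\<bar>)"
      using g by (intro integrable_indicator_mult) auto
    have iI: "integrable leb01 (\<lambda>s. (y - t) * (indicator {0..t} s * g s))"
      using g by (intro integrable_mult_right integrable_indicator_mult) auto
    have ik: "integrable leb01 (\<lambda>s. ?k s * g s)"
      using Bochner_Integration.integrable_diff[OF Bochner_Integration.integrable_diff[OF
          integrable_max_mult[OF g, of y] integrable_max_mult[OF g, of t]] iI]
      by (simp add: algebra_simps)
    have "second_primitive g y - second_primitive g t - (y - t) * primitive g t
        = (LINT s|leb01. max 0 (y - s) * g s) - (LINT s|leb01. max 0 (t - s) * g s)
          - (LINT s|leb01. (y - t) * (indicator {0..t} s * g s))"
      unfolding second_primitive_def primitive_def by simp
    also have "\<dots> = (LINT s|leb01. max 0 (y - s) * g s - max 0 (t - s) * g s - (y - t) * (indicator {0..t} s * g s))"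
      by (simp only: Bochner_Integration.integral_diff[OF integrable_max_mult[OF g] integrable_max_mult[OF g]]
        Bochner_Integration.integral_diff[OF Bochner_Integration.integrable_diff[OF integrable_max_mult[OF g] integrable_max_mult[OF g]] iI])
    also have "\<dots> = (LINT s|leb01. ?k s * g s)"
      by (simp add: algebra_simps)
    finally have eq: "second_primitive g y - second_primitive g t - (y - t) * primitive g t = (LINT s|leb01. ?k s * g s)" .
    have "\<bar>LINT s|leb01. ?k s * g s\<bar> \<le> (LINT s|leb01. \<bar>?k s * g s\<bar>)" by (rule integral_abs_bound)
    also have "\<dots> \<le> (LINT s|leb01. \<bar>y - t\<bar> * (indicator ?A s * \<bar>g s\<bar>))"
    proof (rule integral_mono)
      fix s assume s: "s \<in> space leb01"
      have "\<bar>?k s\<bar> \<le> \<bar>y - t\<bar> * indicator ?A s"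
      proof -
        consider "s \<le> t" "s \<le> y" | "s \<le> t" "y < s" | "t < s" "s \<le> y" | "t < s" "y < s" by linarith
        then show ?thesis
          by cases (use s in \<open>simp_all add: indicator_def\<close>)
      qed
      then have "\<bar>?k s\<bar> * \<bar>g s\<bar> \<le> \<bar>y - t\<bar> * indicator ?A s * \<bar>g s\<bar>" by (intro mult_right_mono) auto
      then show "\<bar>?k s * g s\<bar> \<le> \<bar>y - t\<bar> * (indicator ?A s * \<bar>g s\<bar>)"
        by (simp only: abs_mult mult.assoc)
    qed (intro integrable_abs ik, intro integrable_mult_right iA)
    also have "\<dots> = \<bar>y - t\<bar> * (LINT s|leb01. indicator ?A s * \<bar>g s\<bar>)" by simp
    also have "\<dots> < \<bar>y - t\<bar> * e"
    proof (rule mult_strict_left_mono)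
      show "(LINT s|leb01. indicator ?A s * \<bar>g s\<bar>) < e"
        using y(3) by (intro d(2)) (auto simp: dist_real_def max_def min_def)
    qed (use y in simp)
    finally have "\<bar>second_primitive g y - second_primitive g t - (y - t) * primitive g t\<bar> < \<bar>y - t\<bar> * e"
      unfolding eq .
    moreover have "(second_primitive g y - second_primitive g t) / (y - t) - primitive g t
        = (second_primitive g y - second_primitive g t - (y - t) * primitive g t) / (y - t)"
      using y(2) by (simp add: field_simps)
    ultimately show ?thesis using y(2) unfolding dist_real_def
      by (simp add: abs_divide divide_less_eq mult.commute)
  qed
  then show "\<forall>\<^sub>F y in at t within I01. dist ((second_primitive g y - second_primitive g t) / (y - t)) (primitive g t) < e"
    unfolding eventually_at using d(1) by blast
qed

lemma deriv01_eqI: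
  assumes "t \<in> I01" "(f has_real_derivative D) (at t within I01)"
  shows "deriv01 f t = D"
  unfolding deriv01_def
  using vector_derivative_within_cbox[of 0 1 t f D] assms
  by (simp add: has_real_derivative_iff_has_vector_derivative)

lemma deriv01_cong:
  assumes eq: "\<And>t. t \<in> I01 \<Longrightarrow> u t = w t" and t: "t \<in> I01"
  shows "deriv01 u t = deriv01 w t"
proof -
  have "(u has_vector_derivative D) (at t within I01) \<longleftrightarrow> (w has_vector_derivative D) (at t within I01)" for D
    using has_vector_derivative_transform[OF t, of u w D] has_vector_derivative_transform[OF t, of w u D] eq by auto
  then show ?thesis unfolding deriv01_def vector_derivative_def by simp
qed

lemma absolutely_continuous_on_cong:
  assumes eq: "\<And>t. t \<in> S \<Longrightarrow> f t = g t" and f: "absolutely_continuous_on S f"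
  shows "absolutely_continuous_on S g"
proof -
  have "(\<Sum>K\<in>\<D>. \<bar>incr f K\<bar>) = (\<Sum>K\<in>\<D>. \<bar>incr g K\<bar>)" if D: "\<D> division_of \<Union>\<D>" "\<Union>\<D> \<subseteq> S" for \<D>
  proof (rule sum.cong)
    fix K assume K: "K \<in> \<D>"
    have "Sup K \<in> {Inf K..Sup K}" "Inf K \<in> {Inf K..Sup K}" using interval_of_division(2)[OF D(1) K] by auto
    then have "Sup K \<in> S" "Inf K \<in> S" using interval_of_division(1)[OF D(1) K] K D(2) by auto
    then show "\<bar>incr f K\<bar> = \<bar>incr g K\<bar>" using eq by simp
  qed simp
  with f show ?thesis unfolding absolutely_continuous_on_def by (metis (no_types, lifting))
qed

lemma W21_cong:
  assumes eq: "\<And>t. t \<in> I01 \<Longrightarrow> u t = w t" and u: "u \<in> W21"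
  shows "w \<in> W21"
proof -
  have "continuous_on I01 w" using u eq unfolding W21_def by (metis (no_types, lifting) continuous_on_cong mem_Collect_eq)
  moreover have "w differentiable_on I01"
    unfolding differentiable_on_def
  proof
    fix t :: real assume t: "t \<in> I01"
    have "u differentiable (at t within I01)" using u t unfolding W21_def differentiable_on_def by blast
    then show "w differentiable (at t within I01)"
      by (rule differentiable_transform_within[OF _ zero_less_one t]) (use eq in auto)
  qed
  moreover have "absolutely_continuous_on I01 (deriv01 w)"
    by (rule absolutely_continuous_on_cong[of I01 "deriv01 u"]) (use u deriv01_cong[OF eq] in \<open>auto simp: W21_def\<close>)
  ultimately show ?thesis by (simp add: W21_def)
qed

lemma absolutely_continuous_on_diff:
  assumes f: "absolutely_continuous_on S f" and g: "absolutely_continuous_on S g"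
  shows "absolutely_continuous_on S (\<lambda>t. f t - g t)"
  unfolding absolutely_continuous_on_def
proof (intro allI impI)
  fix e :: real assume "0 < e"
  then have e2: "0 < e / 2" by simp
  obtain d where d: "0 < d"
    "\<And>\<D>. \<D> division_of \<Union>\<D> \<Longrightarrow> \<Union>\<D> \<subseteq> S \<Longrightarrow> measure lebesgue (\<Union>\<D>) < d \<Longrightarrow> (\<Sum>K\<in>\<D>. \<bar>incr f K\<bar>) < e / 2"
    using absolutely_continuous_onD[OF f e2] by blast
  obtain d' where d': "0 < d'"
    "\<And>\<D>. \<D> division_of \<Union>\<D> \<Longrightarrow> \<Union>\<D> \<subseteq> S \<Longrightarrow> measure lebesgue (\<Union>\<D>) < d' \<Longrightarrow> (\<Sum>K\<in>\<D>. \<bar>incr g K\<bar>) < e / 2"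
    using absolutely_continuous_onD[OF g e2] by blast
  have "(\<Sum>K\<in>\<D>. \<bar>incr (\<lambda>t. f t - g t) K\<bar>) < e"
    if D: "\<D> division_of \<Union>\<D>" "\<Union>\<D> \<subseteq> S" "(\<Sum>K\<in>\<D>. Sup K - Inf K) < min d d'" for \<D>
  proof -
    have m: "measure lebesgue (\<Union>\<D>) < d" "measure lebesgue (\<Union>\<D>) < d'"
      using D(3) measure_division[OF D(1)] by auto
    have "(\<Sum>K\<in>\<D>. \<bar>incr (\<lambda>t. f t - g t) K\<bar>) \<le> (\<Sum>K\<in>\<D>. \<bar>incr f K\<bar> + \<bar>incr g K\<bar>)"
      by (rule sum_mono) simp
    also have "\<dots> = (\<Sum>K\<in>\<D>. \<bar>incr f K\<bar>) + (\<Sum>K\<in>\<D>. \<bar>incr g K\<bar>)" by (rule sum.distrib)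
    also have "\<dots> < e" using d(2)[OF D(1,2) m(1)] d'(2)[OF D(1,2) m(2)] by simp
    finally show ?thesis .
  qed
  with d(1) d'(1) show "\<exists>\<delta>>0. \<forall>\<D>. \<D> division_of \<Union>\<D> \<and> \<Union>\<D> \<subseteq> S \<and> (\<Sum>K\<in>\<D>. Sup K - Inf K) < \<delta> \<longrightarrow>
        (\<Sum>K\<in>\<D>. \<bar>incr (\<lambda>t. f t - g t) K\<bar>) < e"
    by (intro exI[of _ "min d d'"]) simp
qed

lemma W21_has_derivative:
  assumes "u \<in> W21" "t \<in> I01"
  shows "(u has_real_derivative deriv01 u t) (at t within I01)"
proof -
  have "u differentiable (at t within I01)" using assms unfolding W21_def differentiable_on_def by blast
  then show ?thesis unfolding deriv01_def
    by (simp add: vector_derivative_works has_real_derivative_iff_has_vector_derivative)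
qed

text \<open>
  Linearity of the second derivative is where almost everywhere differentiability of absolutely
  continuous functions enters: \<open>deriv01\<close> has an unspecified value at points without derivative.
\<close>

lemma W21_diff:
  assumes u: "u \<in> W21" and w: "w \<in> W21"
  shows "(\<lambda>t. u t - w t) \<in> W21"
    and "\<And>t. t \<in> I01 \<Longrightarrow> deriv01 (\<lambda>t. u t - w t) t = deriv01 u t - deriv01 w t"
    and "AE t in leb01. deriv01 (deriv01 (\<lambda>t. u t - w t)) t = deriv01 (deriv01 u) t - deriv01 (deriv01 w) t"
proof -
  have D: "((\<lambda>t. u t - w t) has_real_derivative deriv01 u t - deriv01 w t) (at t within I01)" if "t \<in> I01" for t
    by (intro DERIV_diff W21_has_derivative u w that)
  show d: "deriv01 (\<lambda>t. u t - w t) t = deriv01 u t - deriv01 w t" if "t \<in> I01" for t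
    by (rule deriv01_eqI[OF that D[OF that]])
  have ac: "absolutely_continuous_on I01 (deriv01 u)" "absolutely_continuous_on I01 (deriv01 w)"
    using u w by (auto simp: W21_def)
  have "absolutely_continuous_on I01 (deriv01 (\<lambda>t. u t - w t))"
    by (rule absolutely_continuous_on_cong[OF _ absolutely_continuous_on_diff[OF ac]]) (simp add: d)
  then show "(\<lambda>t. u t - w t) \<in> W21"
    using u w unfolding W21_def by (auto intro: continuous_on_diff)
  have "AE t in leb01. deriv01 u differentiable (at t)" "AE t in leb01. deriv01 w differentiable (at t)"
    using ac by (auto intro: absolutely_continuous_on_differentiable_AE)
  then have "AE t in leb01. t \<in> I01 \<longrightarrow> deriv01 (deriv01 (\<lambda>t. u t - w t)) t = deriv01 (deriv01 u) t - deriv01 (deriv01 w) t"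
  proof eventually_elim
    case (elim t)
    show ?case
    proof
      assume t: "t \<in> I01"
      obtain D E where D: "(deriv01 u has_real_derivative D) (at t)" and E: "(deriv01 w has_real_derivative E) (at t)"
        using elim unfolding real_differentiable_def by blast
      have D': "(deriv01 u has_real_derivative D) (at t within I01)" and E': "(deriv01 w has_real_derivative E) (at t within I01)"
        using D E by (auto intro: has_field_derivative_at_within)
      have "deriv01 (deriv01 (\<lambda>t. u t - w t)) t = deriv01 (\<lambda>t. deriv01 u t - deriv01 w t) t"
        by (rule deriv01_cong[OF d t])
      also have "\<dots> = D - E" by (rule deriv01_eqI[OF t DERIV_diff[OF D' E']])
      finally show "deriv01 (deriv01 (\<lambda>t. u t - w t)) t = deriv01 (deriv01 u) t - deriv01 (deriv01 w) t"
        by (simp add: deriv01_eqI[OF t D'] deriv01_eqI[OF t E'])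
    qed
  qed
  then show "AE t in leb01. deriv01 (deriv01 (\<lambda>t. u t - w t)) t = deriv01 (deriv01 u) t - deriv01 (deriv01 w) t"
    by (rule AE_leb01_in_I01)
qed

text \<open>
  How every solution below is recognised: an integral equation replaces membership in \<open>W21\<close>, the
  initial values and the differential equation.
\<close>

lemma second_primitive_solution:
  assumes g: "integrable leb01 g" and u: "\<forall>t\<in>I01. u t = b * t + second_primitive g t"
  shows "u \<in> W21" and "u 0 = 0"
    and "\<And>t. t \<in> I01 \<Longrightarrow> deriv01 u t = b + primitive g t"
    and "AE t in leb01. deriv01 (deriv01 u) t = g t"
proof -
  have D: "(u has_real_derivative b + primitive g t) (at t within I01)" if t: "t \<in> I01" for t
  proof (rule has_field_derivative_transform_within[OF _ zero_less_one t])
    show "((\<lambda>t. b * t + second_primitive g t) has_real_derivative b + primitive g t) (at t within I01)"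
      by (rule derivative_eq_intros second_primitive_has_derivative[OF g t] | simp)+
  qed (simp add: u)
  show d: "deriv01 u t = b + primitive g t" if "t \<in> I01" for t
    by (rule deriv01_eqI[OF that D[OF that]])
  show "u 0 = 0" by (simp add: u second_primitive_0)
  have "absolutely_continuous_on I01 (\<lambda>t. primitive g t - (- b))"
    by (intro absolutely_continuous_on_diff absolutely_continuous_on_primitive g)
      (auto simp: absolutely_continuous_on_def intro!: exI[of _ 1])
  then have "absolutely_continuous_on I01 (deriv01 u)"
    by (rule absolutely_continuous_on_cong[rotated]) (simp add: d)
  moreover have "u differentiable_on I01"
    using D unfolding differentiable_on_def by (meson real_differentiable_def differentiable_def has_field_derivative_imp_has_derivative)
  ultimately show "u \<in> W21"
    by (simp add: W21_def differentiable_imp_continuous_on)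
  have "AE t in leb01. t \<in> I01 \<longrightarrow> deriv01 (deriv01 u) t = g t"
    using primitive_has_derivative_AE[OF g]
  proof eventually_elim
    case (elim t)
    show ?case
    proof
      assume t: "t \<in> I01"
      have "deriv01 (deriv01 u) t = deriv01 (\<lambda>t. b + primitive g t) t" by (rule deriv01_cong[OF d t])
      also have "\<dots> = 0 + g t"
        by (rule deriv01_eqI[OF t DERIV_add[OF DERIV_const has_field_derivative_at_within[OF elim]]])
      finally show "deriv01 (deriv01 u) t = g t" by simp
    qed
  qed
  then show "AE t in leb01. deriv01 (deriv01 u) t = g t"
    by (rule AE_leb01_in_I01)
qed

section \<open>The Cauchy kernel\<close>

lemma integral_mult_le:
  fixes q h :: "real \<Rightarrow> real"
  assumes q: "integrable leb01 q" and h: "continuous_on I01 h" "\<And>r. r \<in> I01 \<Longrightarrow> \<bar>h r\<bar> \<le> C"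
  shows "\<bar>LINT r|leb01. h r * q r\<bar> \<le> C * (LINT r|leb01. \<bar>q r\<bar>)"
proof -
  have "\<bar>LINT r|leb01. h r * q r\<bar> \<le> (LINT r|leb01. \<bar>h r * q r\<bar>)" by (rule integral_abs_bound)
  also have "\<dots> \<le> (LINT r|leb01. C * \<bar>q r\<bar>)"
  proof (rule integral_mono)
    fix r assume "r \<in> space leb01"
    then have "\<bar>h r\<bar> * \<bar>q r\<bar> \<le> C * \<bar>q r\<bar>" using h(2)[of r] by (intro mult_right_mono) auto
    then show "\<bar>h r * q r\<bar> \<le> C * \<bar>q r\<bar>" by (simp only: abs_mult)
  qed (use q integrable_continuous_mult[OF q h(1)] in \<open>simp_all add: integrable_abs\<close>)
  finally show ?thesis by simp
qed

lemma continuous_on_integral_kernel: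
  fixes \<kappa> :: "'a::metric_space \<Rightarrow> real \<Rightarrow> real"
  assumes q: "integrable leb01 q" and \<kappa>: "continuous_on UNIV (\<lambda>(p, r). \<kappa> p r)"
    and B: "\<And>p r. r \<in> I01 \<Longrightarrow> \<bar>\<kappa> p r\<bar> \<le> B"
  shows "continuous_on UNIV (\<lambda>p. LINT r|leb01. \<kappa> p r * q r)"
proof (rule continuous_on_sequentiallyI)
  fix x p assume x: "x \<longlonglongrightarrow> (p::'a)"
  have int: "integrable leb01 (\<lambda>r. \<kappa> y r * q r)" for y
  proof (rule integrable_continuous_mult[OF q])
    have "continuous_on I01 (\<lambda>r. (\<lambda>(p, r). \<kappa> p r) (y, r))"
      by (rule continuous_on_compose2[OF \<kappa>]) (intro continuous_intros, simp)
    then show "continuous_on I01 (\<kappa> y)" by simp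
  qed
  show "(\<lambda>n. LINT r|leb01. \<kappa> (x n) r * q r) \<longlonglongrightarrow> (LINT r|leb01. \<kappa> p r * q r)"
  proof (rule integral_dominated_convergence[where w = "\<lambda>r. B * \<bar>q r\<bar>"])
    show "(\<lambda>r. \<kappa> p r * q r) \<in> borel_measurable leb01" using int by blast
    show "(\<lambda>r. \<kappa> (x n) r * q r) \<in> borel_measurable leb01" for n using int by blast
    show "integrable leb01 (\<lambda>r. B * \<bar>q r\<bar>)" using q by simp
    show "AE r in leb01. (\<lambda>n. \<kappa> (x n) r * q r) \<longlonglongrightarrow> \<kappa> p r * q r"
    proof (rule AE_I2)
      fix r
      have "(\<lambda>n. (\<lambda>(p, r). \<kappa> p r) (x n, r)) \<longlonglongrightarrow> (\<lambda>(p, r). \<kappa> p r) (p, r)"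
        by (rule continuous_on_tendsto_compose[OF \<kappa>]) (auto intro: tendsto_Pair x)
      then show "(\<lambda>n. \<kappa> (x n) r * q r) \<longlonglongrightarrow> \<kappa> p r * q r" by (intro tendsto_intros) simp
    qed
    show "AE r in leb01. norm (\<kappa> (x n) r * q r) \<le> B * \<bar>q r\<bar>" for n
    proof (rule AE_I2)
      fix r assume "r \<in> space leb01"
      then have "\<bar>\<kappa> (x n) r\<bar> * \<bar>q r\<bar> \<le> B * \<bar>q r\<bar>" using B[of r "x n"] by (intro mult_right_mono) auto
      then show "norm (\<kappa> (x n) r * q r) \<le> B * \<bar>q r\<bar>" by (simp only: real_norm_def abs_mult)
    qed
  qed
qed

text \<open>
  For \<open>q = a + lam\<close>, the function \<open>\<lambda>t. K t s\<close> vanishes up to \<open>s\<close> and from there on solves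
  \<open>u'' + q u = 0\<close> with \<open>u s = 0\<close> and \<open>u' s = 1\<close>; the integral equation expresses this.
\<close>

locale Cauchy_kernel =
  fixes q :: "real \<Rightarrow> real" and K :: "real \<Rightarrow> real \<Rightarrow> real" and B :: real
  assumes q: "integrable leb01 q"
    and K_continuous: "continuous_on UNIV (\<lambda>(t, s). K t s)"
    and K_bounded: "\<And>t s. \<bar>K t s\<bar> \<le> B"
    and K_eq: "\<And>t s. t \<in> I01 \<Longrightarrow> s \<in> I01 \<Longrightarrow> K t s = max 0 (t - s) - second_primitive (\<lambda>r. q r * K r s) t"
    and K_eq_0: "\<And>t s. t \<in> I01 \<Longrightarrow> s \<in> I01 \<Longrightarrow> t \<le> s \<Longrightarrow> K t s = 0"

text \<open>
  The integral equation is solved simultaneously for all \<open>s\<close> by Banach's fixed point theorem, for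
  bounded continuous functions on the plane, with \<open>t\<close> clamped to \<open>I01\<close>. The unknown is
  \<open>exp (- k * t) * K t s\<close>: the weight replaces \<open>max 0 x\<close> by \<open>w x = max 0 x * exp (- k * x)\<close>, which is
  at most \<open>1 / k\<close>, so for large \<open>k\<close> the map contracts although \<open>q\<close> is only integrable. Below the
  diagonal the inhomogeneity vanishes, and iterating the equation bounds the solution by
  \<open>(1 / 2) ^ n\<close>.
\<close>

lemma Cauchy_kernel_exists:
  assumes q: "integrable leb01 q"
  shows "\<exists>K B. Cauchy_kernel q K B"
proof -
  define N where "N = (LINT r|leb01. \<bar>q r\<bar>)"
  have N: "N \<ge> 0" by (simp add: N_def)
  \<comment> \<open>the contraction constant is \<open>N / k\<close>, at most \<open>1 / 2\<close>\<close>
  define k where "k = 2 * N + 1"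
  have k: "k > 0" using N by (simp add: k_def)
  have Nk: "1 / k * N \<le> 1 / 2" using N by (simp add: k_def field_simps)
  define c :: "real \<Rightarrow> real" where "c t = max 0 (min 1 t)" for t
  have c01: "c t \<in> I01" for t by (simp add: c_def)
  have cid: "c t = t" if "t \<in> I01" for t using that by (simp add: c_def)
  have cc: "continuous_on S c" for S unfolding c_def by (intro continuous_intros)
  define w :: "real \<Rightarrow> real" where "w x = max 0 x * exp (- k * x)" for x
  have wc: "continuous_on UNIV w" unfolding w_def by (intro continuous_intros)
  have w0: "w x = 0" if "x \<le> 0" for x using that by (simp add: w_def)
  have w1: "\<bar>w x\<bar> \<le> 1 / k" for x
  proof (cases "x \<le> 0")
    case True
    then show ?thesis using k by (simp add: w0)
  next
    case False
    have "k * x \<le> exp (k * x)" using exp_ge_add_one_self[of "k * x"] by linarith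
    then have "x * exp (- (k * x)) \<le> 1 / k" using k by (simp add: exp_minus field_simps)
    then show ?thesis using False by (simp add: w_def)
  qed
  define \<kappa> where "\<kappa> v p r = w (c (fst p) - r) * apply_bcontfun v (r, snd p)" for v :: "(real \<times> real) \<Rightarrow>\<^sub>C real" and p r
  have vc: "continuous_on UNIV (apply_bcontfun v)" for v :: "(real \<times> real) \<Rightarrow>\<^sub>C real" by simp
  have kc: "continuous_on UNIV (\<lambda>(p, r). \<kappa> v p r)" for v
    unfolding \<kappa>_def case_prod_unfold
    by (intro continuous_intros continuous_on_compose2[OF wc] continuous_on_compose2[OF cc[of UNIV]]
        continuous_on_compose2[OF vc]) auto
  have kc1: "continuous_on I01 (\<kappa> v p)" for v p
    unfolding \<kappa>_def
    by (intro continuous_intros continuous_on_compose2[OF wc] continuous_on_compose2[OF vc]) auto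
  have kb: "\<bar>\<kappa> v p r\<bar> \<le> 1 / k * norm v" for v p r
    unfolding \<kappa>_def abs_mult
    by (intro mult_mono w1) (use norm_bounded[of v "(r, snd p)"] k in auto)
  define \<Phi> where "\<Phi> v p = exp (- k * c (fst p)) * max 0 (c (fst p) - c (snd p)) - (LINT r|leb01. \<kappa> v p r * q r)"
    for v :: "(real \<times> real) \<Rightarrow>\<^sub>C real" and p
  have \<Phi>b: "\<Phi> v \<in> bcontfun" for v
  proof (rule bcontfun_normI)
    have "continuous_on UNIV (\<lambda>p. LINT r|leb01. \<kappa> v p r * q r)"
      by (rule continuous_on_integral_kernel[OF q kc]) (rule kb)
    then show "continuous_on UNIV (\<Phi> v)" unfolding \<Phi>_def
      by (intro continuous_intros continuous_on_compose2[OF cc[of UNIV]]) auto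
    fix p
    have "\<bar>LINT r|leb01. \<kappa> v p r * q r\<bar> \<le> 1 / k * norm v * N"
      unfolding N_def by (rule integral_mult_le[OF q kc1]) (rule kb)
    moreover have "\<bar>exp (- k * c (fst p)) * max 0 (c (fst p) - c (snd p))\<bar> \<le> 1 * 1"
      unfolding abs_mult by (rule mult_mono) (use c01 k in \<open>auto simp: c_def\<close>)
    ultimately show "norm (\<Phi> v p) \<le> 1 + 1 / k * norm v * N" unfolding \<Phi>_def real_norm_def by linarith
  qed
  have ap: "apply_bcontfun (Bcontfun (\<Phi> v)) = \<Phi> v" for v by (rule Bcontfun_inverse[OF \<Phi>b])
  have "\<exists>!v. Bcontfun (\<Phi> v) = v"
  proof (rule banach_fix_type[of "1 / 2"])
    show "\<forall>v u. dist (Bcontfun (\<Phi> v)) (Bcontfun (\<Phi> u)) \<le> 1 / 2 * dist v u"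
    proof (intro allI dist_bound)
      fix v u p
      have i: "integrable leb01 (\<lambda>r. \<kappa> v p r * q r)" for v
        by (rule integrable_continuous_mult[OF q kc1])
      have "\<Phi> u p - \<Phi> v p = (LINT r|leb01. \<kappa> v p r * q r) - (LINT r|leb01. \<kappa> u p r * q r)"
        by (simp add: \<Phi>_def)
      also have "\<dots> = (LINT r|leb01. \<kappa> v p r * q r - \<kappa> u p r * q r)"
        by (rule Bochner_Integration.integral_diff[symmetric]) (rule i)+
      also have "\<dots> = (LINT r|leb01. (\<kappa> v p r - \<kappa> u p r) * q r)" by (simp only: left_diff_distrib)
      finally have eq: "\<Phi> u p - \<Phi> v p = (LINT r|leb01. (\<kappa> v p r - \<kappa> u p r) * q r)" .
      have "\<bar>\<Phi> u p - \<Phi> v p\<bar> \<le> 1 / k * dist v u * N"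
        unfolding eq N_def
      proof (rule integral_mult_le[OF q])
        show "continuous_on I01 (\<lambda>r. \<kappa> v p r - \<kappa> u p r)" by (intro continuous_on_diff kc1)
        fix r
        have "\<bar>apply_bcontfun v (r, snd p) - apply_bcontfun u (r, snd p)\<bar> \<le> dist v u"
          using dist_bounded[of v "(r, snd p)" u] by (simp add: dist_real_def)
        then have "\<bar>w (c (fst p) - r)\<bar> * \<bar>apply_bcontfun v (r, snd p) - apply_bcontfun u (r, snd p)\<bar> \<le> 1 / k * dist v u"
          using k by (intro mult_mono w1) auto
        then show "\<bar>\<kappa> v p r - \<kappa> u p r\<bar> \<le> 1 / k * dist v u"
          unfolding \<kappa>_def by (simp only: right_diff_distrib[symmetric] abs_mult)
      qed
      also have "\<dots> \<le> 1 / 2 * dist v u" using mult_right_mono[OF Nk, of "dist v u"] by (simp add: mult_ac)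
      finally show "dist (apply_bcontfun (Bcontfun (\<Phi> v)) p) (apply_bcontfun (Bcontfun (\<Phi> u)) p) \<le> 1 / 2 * dist v u"
        unfolding ap by (simp add: dist_real_def abs_minus_commute)
    qed
  qed auto
  then obtain v where "Bcontfun (\<Phi> v) = v" by blast
  then have v: "apply_bcontfun v p = \<Phi> v p" for p using ap[of v] by simp
  have vv: "apply_bcontfun v (t, s) = exp (- k * t) * max 0 (t - s) - (LINT r|leb01. (w (t - r) * apply_bcontfun v (r, s)) * q r)"
    if "t \<in> I01" "s \<in> I01" for t s
    unfolding v[of "(t, s)"] unfolding \<Phi>_def \<kappa>_def by (simp add: cid[OF that(1)] cid[OF that(2)])
  have small: "\<bar>apply_bcontfun v (t, s)\<bar> \<le> norm v * (1 / 2) ^ n" if "t \<in> I01" "s \<in> I01" "t \<le> s" for n t s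
    using that(1,3)
  proof (induction n arbitrary: t)
    case 0
    show ?case using norm_bounded[of v "(t, s)"] by simp
  next
    case (Suc n)
    have "apply_bcontfun v (t, s) = - (LINT r|leb01. (w (t - r) * apply_bcontfun v (r, s)) * q r)"
      using vv[OF Suc.prems(1) that(2)] Suc.prems(2) by simp
    moreover have "\<bar>LINT r|leb01. (w (t - r) * apply_bcontfun v (r, s)) * q r\<bar> \<le> (1 / k * (norm v * (1 / 2) ^ n)) * N"
      unfolding N_def
    proof (rule integral_mult_le[OF q])
      show "continuous_on I01 (\<lambda>r. w (t - r) * apply_bcontfun v (r, s))"
        by (intro continuous_intros continuous_on_compose2[OF wc] continuous_on_compose2[OF vc]) auto
      fix r :: real assume r: "r \<in> I01"
      show "\<bar>w (t - r) * apply_bcontfun v (r, s)\<bar> \<le> 1 / k * (norm v * (1 / 2) ^ n)"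
      proof (cases "r \<le> t")
        case True
        then have "\<bar>apply_bcontfun v (r, s)\<bar> \<le> norm v * (1 / 2) ^ n" using r Suc.prems by (intro Suc.IH) auto
        then show ?thesis unfolding abs_mult using k by (intro mult_mono w1) auto
      next
        case False
        then show ?thesis using k by (simp add: w0)
      qed
    qed
    moreover have "(1 / k * (norm v * (1 / 2) ^ n)) * N \<le> norm v * (1 / 2) ^ Suc n"
      using mult_right_mono[OF Nk, of "norm v * (1 / 2) ^ n"] by (simp add: mult_ac)
    ultimately show ?case by linarith
  qed
  define K where "K t s = exp (k * c t) * apply_bcontfun v (t, s)" for t s
  show ?thesis
  proof (intro exI[of _ K] exI[of _ "exp k * norm v"] Cauchy_kernel.intro q)
    show "continuous_on UNIV (\<lambda>(t, s). K t s)"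
      unfolding K_def case_prod_unfold
      by (intro continuous_intros continuous_on_compose2[OF cc[of UNIV]] continuous_on_compose2[OF vc]) auto
    show "\<bar>K t s\<bar> \<le> exp k * norm v" for t s
      unfolding K_def abs_mult
    proof (rule mult_mono)
      have "k * c t \<le> k * 1" using c01[of t] k by (intro mult_left_mono) auto
      then show "\<bar>exp (k * c t)\<bar> \<le> exp k" by simp
      show "\<bar>apply_bcontfun v (t, s)\<bar> \<le> norm v" using norm_bounded[of v "(t, s)"] by simp
    qed auto
    show "K t s = 0" if "t \<in> I01" "s \<in> I01" "t \<le> s" for t s
    proof -
      have "(\<lambda>n. norm v * (1 / 2) ^ n) \<longlonglongrightarrow> norm v * 0"
        by (intro tendsto_intros LIMSEQ_power_zero) simp
      then have "\<bar>apply_bcontfun v (t, s)\<bar> \<le> 0"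
        by (intro LIMSEQ_le_const[of _ 0]) (use small[OF that] in auto)
      then show ?thesis by (simp add: K_def)
    qed
    show "K t s = max 0 (t - s) - second_primitive (\<lambda>r. q r * K r s) t" if t: "t \<in> I01" and s: "s \<in> I01" for t s
    proof -
      have e: "exp (k * t) * (w (t - r) * apply_bcontfun v (r, s) * q r) = max 0 (t - r) * (q r * K r s)" if "r \<in> I01" for r
      proof -
        have "exp (k * t) * exp (- k * (t - r)) = exp (k * r)"
          by (simp add: exp_add[symmetric] algebra_simps)
        moreover have "a * (m * b * x * y) = m * (y * ((a * b) * x))" for a m b x y :: real
          by (simp add: mult_ac)
        ultimately show ?thesis unfolding w_def K_def cid[OF that] by simp
      qed
      have "second_primitive (\<lambda>r. q r * K r s) t = (LINT r|leb01. exp (k * t) * (w (t - r) * apply_bcontfun v (r, s) * q r))"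
        unfolding second_primitive_def
      proof (rule Bochner_Integration.integral_cong[OF refl])
        fix r assume "r \<in> space leb01"
        then have "r \<in> I01" by simp
        from e[OF this] show "max 0 (t - r) * (q r * K r s) = exp (k * t) * (w (t - r) * apply_bcontfun v (r, s) * q r)"
          by (rule sym)
      qed
      also have "\<dots> = exp (k * t) * (LINT r|leb01. w (t - r) * apply_bcontfun v (r, s) * q r)" by simp
      also have "\<dots> = exp (k * t) * (exp (- k * t) * max 0 (t - s) - apply_bcontfun v (t, s))"
        using vv[OF t s] by simp
      also have "\<dots> = max 0 (t - s) - K t s"
        unfolding K_def cid[OF t] by (simp add: right_diff_distrib mult.assoc[symmetric] exp_minus)
      finally show ?thesis by simp
    qed
  qed
qed

section \<open>Green's functions: criterion and uniqueness\<close>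

lemma second_primitive_diff:
  assumes "integrable leb01 f" "integrable leb01 g"
  shows "second_primitive (\<lambda>r. f r - g r) t = second_primitive f t - second_primitive g t"
  unfolding second_primitive_def right_diff_distrib
  by (rule Bochner_Integration.integral_diff) (intro integrable_max_mult assms)+

lemma second_primitive_mult: "second_primitive (\<lambda>r. c * f r) t = c * second_primitive f t"
proof -
  have "second_primitive (\<lambda>r. c * f r) t = (LINT s|leb01. c * (max 0 (t - s) * f s))"
    unfolding second_primitive_def by (rule Bochner_Integration.integral_cong) (simp_all add: mult_ac)
  then show ?thesis by (simp add: second_primitive_def)
qed

lemma hill_op_diff_AE:
  assumes u: "u \<in> W21" "AE t in leb01. hill_op a lam u t = f t"
    and w: "w \<in> W21" "AE t in leb01. hill_op a lam w t = f t"
  shows "AE t in leb01. hill_op a lam (\<lambda>t. u t - w t) t = 0"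
  using W21_diff(3)[OF u(1) w(1)] u(2) w(2)
proof eventually_elim
  case (elim t)
  then show ?case unfolding hill_op_def by (simp add: right_diff_distrib)
qed

lemma X_D_diff: "u \<in> X_D \<Longrightarrow> w \<in> X_D \<Longrightarrow> (\<lambda>t. u t - w t) \<in> X_D"
  unfolding X_D_def by (simp add: W21_diff)

lemma X_M2_diff: "u \<in> X_M2 \<Longrightarrow> w \<in> X_M2 \<Longrightarrow> (\<lambda>t. u t - w t) \<in> X_M2"
  unfolding X_M2_def by (simp add: W21_diff)

lemma X_D_cong: "u \<in> X_D \<Longrightarrow> (\<And>t. t \<in> I01 \<Longrightarrow> u t = w t) \<Longrightarrow> w \<in> X_D"
  unfolding X_D_def using W21_cong[of u w] by simp

lemma X_M2_cong: "u \<in> X_M2 \<Longrightarrow> (\<And>t. t \<in> I01 \<Longrightarrow> u t = w t) \<Longrightarrow> w \<in> X_M2"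
  unfolding X_M2_def using W21_cong[of u w] deriv01_cong[of u w 1] by simp

text \<open>
  That \<open>G\<close> produces solutions is enough: nonresonance, applied to the difference of two solutions,
  gives the uniqueness contained in \<open>is_green_function\<close>.
\<close>

lemma is_green_functionI:
  assumes nonres: "nonresonant a lam X" and X: "X \<subseteq> W21"
    and diff: "\<And>u w. u \<in> X \<Longrightarrow> w \<in> X \<Longrightarrow> (\<lambda>t. u t - w t) \<in> X"
    and cong: "\<And>u w. u \<in> X \<Longrightarrow> (\<And>t. t \<in> I01 \<Longrightarrow> u t = w t) \<Longrightarrow> w \<in> X"
    and cont: "continuous_on (I01 \<times> I01) (\<lambda>(t, s). G t s)"
    and sol: "\<And>\<sigma>. integrable leb01 \<sigma> \<Longrightarrow> (\<lambda>t. LINT s|leb01. G t s * \<sigma> s) \<in> X"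
      "\<And>\<sigma>. integrable leb01 \<sigma> \<Longrightarrow> AE t in leb01. hill_op a lam (\<lambda>t. LINT s|leb01. G t s * \<sigma> s) t = \<sigma> t"
  shows "is_green_function a lam X G"
  unfolding is_green_function_def
proof (intro conjI cont allI impI iffI)
  fix \<sigma> u :: "real \<Rightarrow> real" assume \<sigma>: "integrable leb01 \<sigma>"
  let ?U = "\<lambda>t. LINT s|leb01. G t s * \<sigma> s"
  {
    assume u: "u \<in> X \<and> (AE t in leb01. hill_op a lam u t = \<sigma> t)"
    have "AE t in leb01. hill_op a lam (\<lambda>t. u t - ?U t) t = 0"
      using u X sol[OF \<sigma>] by (intro hill_op_diff_AE[of _ _ _ \<sigma>]) auto
    moreover have "(\<lambda>t. u t - ?U t) \<in> X" using u sol(1)[OF \<sigma>] by (intro diff) auto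
    ultimately have "\<forall>t\<in>I01. u t - ?U t = 0" using nonres unfolding nonresonant_def by blast
    then show "\<forall>t\<in>I01. u t = ?U t" by simp
  next
    assume eq: "\<forall>t\<in>I01. u t = ?U t"
    show "u \<in> X" by (rule cong[OF sol(1)[OF \<sigma>]]) (use eq in simp)
    have d1: "deriv01 u t = deriv01 ?U t" if "t \<in> I01" for t
      by (rule deriv01_cong[OF _ that]) (use eq in simp)
    have d2: "deriv01 (deriv01 u) t = deriv01 (deriv01 ?U) t" if "t \<in> I01" for t
      by (rule deriv01_cong[OF d1 that])
    have "AE t in leb01. t \<in> I01 \<longrightarrow> hill_op a lam u t = \<sigma> t"
      using sol(2)[OF \<sigma>]
    proof eventually_elim
      case (elim t)
      show ?case
      proof
        assume t: "t \<in> I01"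
        show "hill_op a lam u t = \<sigma> t"
          using elim unfolding hill_op_def by (simp only: d2[OF t] bspec[OF eq t])
      qed
    qed
    then show "AE t in leb01. hill_op a lam u t = \<sigma> t" by (rule AE_leb01_in_I01)
  }
qed

lemma is_green_function_iff:
  assumes G: "is_green_function a lam X G" and \<sigma>: "integrable leb01 \<sigma>"
  shows "u \<in> X \<and> (AE t in leb01. hill_op a lam u t = \<sigma> t) \<longleftrightarrow> (\<forall>t\<in>I01. u t = (LINT s|leb01. G t s * \<sigma> s))"
proof -
  have "\<forall>\<sigma>. integrable leb01 \<sigma> \<longrightarrow> (\<forall>u. (u \<in> X \<and> (AE t in leb01. hill_op a lam u t = \<sigma> t)) \<longleftrightarrow>
             (\<forall>t\<in>I01. u t = (LINT s|leb01. G t s * \<sigma> s)))"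
    using G unfolding is_green_function_def by (rule conjunct2)
  from mp[OF spec[OF this] \<sigma>] show ?thesis by (rule spec)
qed

lemma continuous_on_section:
  assumes "continuous_on (I01 \<times> I01) (\<lambda>(t, s). G t s)" "t \<in> I01"
  shows "continuous_on I01 (G t)"
proof -
  have "continuous_on I01 (\<lambda>s. (\<lambda>(t, s). G t s) (t, s))"
    by (rule continuous_on_compose2[OF assms(1)]) (use assms(2) in \<open>auto intro!: continuous_intros\<close>)
  then show ?thesis by simp
qed

text \<open>
  Both kernels give the same solution for every right-hand side; take \<open>G t - H t\<close> itself.
\<close>

lemma is_green_function_unique:
  assumes G: "is_green_function a lam X G" and H: "is_green_function a lam X H"
    and t: "t \<in> I01" and s: "s \<in> I01"
  shows "G t s = H t s"
proof -
  have Gc: "continuous_on I01 (G t)"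
    by (rule continuous_on_section[OF _ t]) (use G in \<open>unfold is_green_function_def, blast\<close>)
  have Hc: "continuous_on I01 (H t)"
    by (rule continuous_on_section[OF _ t]) (use H in \<open>unfold is_green_function_def, blast\<close>)
  define \<sigma> where "\<sigma> = (\<lambda>s. G t s - H t s)"
  have \<sigma>c: "continuous_on I01 \<sigma>" unfolding \<sigma>_def by (intro continuous_on_diff Gc Hc)
  have \<sigma>: "integrable leb01 \<sigma>"
    using integrable_continuous_mult[OF integrable_const_leb01[of 1] \<sigma>c] by simp
  have "(\<lambda>t. LINT s|leb01. G t s * \<sigma> s) \<in> X \<and> (AE t in leb01. hill_op a lam (\<lambda>t. LINT s|leb01. G t s * \<sigma> s) t = \<sigma> t)"
    by (subst is_green_function_iff[OF G \<sigma>]) simp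
  then have "\<forall>t\<in>I01. (LINT s|leb01. G t s * \<sigma> s) = (LINT s|leb01. H t s * \<sigma> s)"
    by (subst (asm) is_green_function_iff[OF H \<sigma>])
  then have "(LINT s|leb01. G t s * \<sigma> s) - (LINT s|leb01. H t s * \<sigma> s) = 0" using t by simp
  also have "(LINT s|leb01. G t s * \<sigma> s) - (LINT s|leb01. H t s * \<sigma> s) = (LINT s|leb01. G t s * \<sigma> s - H t s * \<sigma> s)"
    by (intro Bochner_Integration.integral_diff[symmetric] integrable_continuous_mult \<sigma> Gc Hc)
  also have "\<dots> = (LINT s|leb01. \<sigma> s * \<sigma> s)"
    by (rule Bochner_Integration.integral_cong) (simp_all add: \<sigma>_def left_diff_distrib)
  also have "\<dots> = integral I01 (\<lambda>s. \<sigma> s * \<sigma> s)"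
    by (rule lebesgue_integral_eq_integral[OF integrable_continuous_mult[OF \<sigma> \<sigma>c]]) simp
  finally have "integral I01 (\<lambda>s. \<sigma> s * \<sigma> s) = 0" .
  moreover have c: "continuous_on I01 (\<lambda>s. \<sigma> s * \<sigma> s)" by (intro continuous_intros \<sigma>c)
  ultimately have "((\<lambda>s. \<sigma> s * \<sigma> s) has_integral 0) (cbox 0 1)"
    using integrable_continuous_real[OF c] by (metis box_real(2) integrable_integral)
  then have "\<sigma> s * \<sigma> s = 0"
    by (rule has_integral_0_cbox_imp_0[of 0 1 "\<lambda>s. \<sigma> s * \<sigma> s", rotated 2]) (use c s in auto)
  then show ?thesis by (simp add: \<sigma>_def)
qed

lemma green_eq:
  assumes "is_green_function a lam X G" "t \<in> I01" "s \<in> I01"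
  shows "green a lam X t s = G t s"
  by (rule is_green_function_unique[OF _ assms]) (unfold green_def, rule someI[of "is_green_function a lam X", OF assms(1)])

section \<open>Solutions and Green's functions in terms of the Cauchy kernel\<close>

context Cauchy_kernel
begin

lemma K_continuous_compose:
  assumes "continuous_on S f" "continuous_on S g"
  shows "continuous_on S (\<lambda>x. K (f x) (g x))"
proof -
  have "continuous_on S (\<lambda>x. (\<lambda>(t, s). K t s) (f x, g x))"
    by (rule continuous_on_compose2[OF K_continuous]) (intro continuous_on_Pair assms, simp)
  then show ?thesis by simp
qed

lemma integrable_qK: "integrable leb01 (\<lambda>r. q r * K r s)"
  using integrable_continuous_mult[OF q, of "\<lambda>r. K r s"] K_continuous_compose[of I01 "\<lambda>r. r" "\<lambda>_. s"]
  by (simp add: mult.commute continuous_on_id continuous_on_const)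

text \<open>
  The solution with right-hand side \<open>\<sigma>\<close> and zero initial data.
\<close>

definition particular :: "(real \<Rightarrow> real) \<Rightarrow> real \<Rightarrow> real" where
  "particular \<sigma> t = (LINT s|leb01. K t s * \<sigma> s)"

lemma integrable_K_mult:
  assumes "integrable leb01 \<sigma>"
  shows "integrable leb01 (\<lambda>s. K t s * \<sigma> s)"
proof (rule integrable_continuous_mult[OF assms])
  have "continuous_on I01 (\<lambda>s. K t s)" by (intro K_continuous_compose continuous_on_id continuous_on_const)
  then show "continuous_on I01 (K t)" .
qed

lemma particular_continuous:
  assumes "integrable leb01 \<sigma>"
  shows "continuous_on S (particular \<sigma>)"
  unfolding particular_def
  by (rule continuous_on_subset[OF continuous_on_integral_kernel[OF assms K_continuous K_bounded]]) simp

lemma integrable_q_particular: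
  assumes "integrable leb01 \<sigma>"
  shows "integrable leb01 (\<lambda>r. q r * particular \<sigma> r)"
  using integrable_continuous_mult[OF q particular_continuous[OF assms]] by (simp add: mult.commute)

lemma Fubini_kernel:
  assumes h: "integrable leb01 h" and \<sigma>: "integrable leb01 \<sigma>"
  shows "(LINT s|leb01. (LINT r|leb01. h r * K r s) * \<sigma> s) = (LINT r|leb01. h r * particular \<sigma> r)"
proof -
  interpret finite_measure leb01 by (rule finite_measure_leb01)
  interpret pair_sigma_finite leb01 leb01 by unfold_locales
  have hm [measurable]: "h \<in> borel_measurable leb01" and \<sigma>m [measurable]: "\<sigma> \<in> borel_measurable leb01"
    using h \<sigma> by auto
  have prod: "integrable (leb01 \<Otimes>\<^sub>M leb01) (\<lambda>(r, s). h r * \<sigma> s)"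
  proof (rule Fubini_integrable)
    show "(\<lambda>(r, s). h r * \<sigma> s) \<in> borel_measurable (leb01 \<Otimes>\<^sub>M leb01)" by measurable
    show "integrable leb01 (\<lambda>r. LINT s|leb01. norm (case (r, s) of (r, s) \<Rightarrow> h r * \<sigma> s))"
      using h by (simp add: abs_mult)
    show "AE r in leb01. integrable leb01 (\<lambda>s. case (r, s) of (r, s) \<Rightarrow> h r * \<sigma> s)"
      using \<sigma> by simp
  qed
  have idm: "(\<lambda>x. x) \<in> measurable leb01 borel"
    by (rule borel_measurable_integrable[where 'b = real])
       (use integrable_continuous_mult[OF integrable_const_leb01[of 1], of "\<lambda>x. x"] continuous_on_id in simp)
  have "(\<lambda>p. (fst p, snd p)) \<in> measurable (leb01 \<Otimes>\<^sub>M leb01) (borel \<Otimes>\<^sub>M borel)"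
    by (intro measurable_Pair measurable_compose[OF measurable_fst idm] measurable_compose[OF measurable_snd idm])
  moreover have "(\<lambda>(t, s). K t s) \<in> borel_measurable (borel \<Otimes>\<^sub>M borel)"
    unfolding borel_prod by (rule borel_measurable_continuous_onI[OF K_continuous])
  ultimately have "(\<lambda>p. (\<lambda>(t, s). K t s) (fst p, snd p)) \<in> borel_measurable (leb01 \<Otimes>\<^sub>M leb01)"
    by (rule measurable_compose)
  then have Km [measurable]: "(\<lambda>p. K (fst p) (snd p)) \<in> borel_measurable (leb01 \<Otimes>\<^sub>M leb01)" by simp
  have "integrable (leb01 \<Otimes>\<^sub>M leb01) (\<lambda>(r, s). h r * K r s * \<sigma> s)"
  proof (rule Bochner_Integration.integrable_bound)
    show "integrable (leb01 \<Otimes>\<^sub>M leb01) (\<lambda>p. B * (case p of (r, s) \<Rightarrow> h r * \<sigma> s))"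
      using prod by (rule integrable_mult_right)
    show "(\<lambda>(r, s). h r * K r s * \<sigma> s) \<in> borel_measurable (leb01 \<Otimes>\<^sub>M leb01)"
      unfolding case_prod_unfold by measurable
    have "\<bar>h r * K r s * \<sigma> s\<bar> \<le> \<bar>B * (h r * \<sigma> s)\<bar>" for r s
    proof -
      have "\<bar>K r s\<bar> \<le> \<bar>B\<bar>" using K_bounded[of r s] by linarith
      then have "\<bar>K r s\<bar> * (\<bar>h r\<bar> * \<bar>\<sigma> s\<bar>) \<le> \<bar>B\<bar> * (\<bar>h r\<bar> * \<bar>\<sigma> s\<bar>)" by (intro mult_right_mono) auto
      then show ?thesis by (simp add: abs_mult mult_ac)
    qed
    then show "AE p in leb01 \<Otimes>\<^sub>M leb01. norm (case p of (r, s) \<Rightarrow> h r * K r s * \<sigma> s) \<le> norm (B * (case p of (r, s) \<Rightarrow> h r * \<sigma> s))"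
      by (intro AE_I2) (simp add: case_prod_unfold)
  qed
  from Fubini_integral[OF this]
  have "(LINT s|leb01. LINT r|leb01. h r * K r s * \<sigma> s) = (LINT r|leb01. LINT s|leb01. h r * K r s * \<sigma> s)" .
  also have "\<dots> = (LINT r|leb01. h r * particular \<sigma> r)"
    unfolding particular_def by (simp add: mult.assoc)
  finally show ?thesis by simp
qed

text \<open>
  Variation of constants: integrate the equation of \<open>K\<close> against \<open>\<sigma>\<close> and exchange the integrals.
\<close>

lemma particular_eq:
  assumes \<sigma>: "integrable leb01 \<sigma>" and t: "t \<in> I01"
  shows "particular \<sigma> t = second_primitive (\<lambda>r. \<sigma> r - q r * particular \<sigma> r) t"
proof -
  have h: "integrable leb01 (\<lambda>r. max 0 (t - r) * q r)" by (rule integrable_max_mult[OF q])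
  let ?J = "\<lambda>s. LINT r|leb01. max 0 (t - r) * q r * K r s"
  have J: "?J s = second_primitive (\<lambda>r. q r * K r s) t" for s
    by (simp add: second_primitive_def mult.assoc)
  have Keq: "K t s * \<sigma> s = max 0 (t - s) * \<sigma> s - ?J s * \<sigma> s" if "s \<in> I01" for s
    unfolding J K_eq[OF t that] by (simp add: left_diff_distrib)
  have iJ: "integrable leb01 (\<lambda>s. ?J s * \<sigma> s)"
  proof (rule Bochner_Integration.integrable_cong[THEN iffD1, OF refl])
    show "integrable leb01 (\<lambda>s. max 0 (t - s) * \<sigma> s - K t s * \<sigma> s)"
      by (intro Bochner_Integration.integrable_diff integrable_max_mult integrable_K_mult \<sigma>)
    show "max 0 (t - s) * \<sigma> s - K t s * \<sigma> s = ?J s * \<sigma> s" if "s \<in> space leb01" for s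
      using Keq[of s] that by simp
  qed
  have "particular \<sigma> t = (LINT s|leb01. max 0 (t - s) * \<sigma> s - ?J s * \<sigma> s)"
    unfolding particular_def
  proof (rule Bochner_Integration.integral_cong[OF refl])
    show "K t s * \<sigma> s = max 0 (t - s) * \<sigma> s - ?J s * \<sigma> s" if "s \<in> space leb01" for s
      by (rule Keq) (use that in simp)
  qed
  also have "\<dots> = second_primitive \<sigma> t - (LINT s|leb01. ?J s * \<sigma> s)"
    unfolding second_primitive_def by (rule Bochner_Integration.integral_diff[OF integrable_max_mult[OF \<sigma>] iJ])
  also have "(LINT s|leb01. ?J s * \<sigma> s) = (LINT r|leb01. max 0 (t - r) * q r * particular \<sigma> r)"
    by (rule Fubini_kernel[OF h \<sigma>])
  also have "\<dots> = second_primitive (\<lambda>r. q r * particular \<sigma> r) t"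
    by (simp add: second_primitive_def mult.assoc)
  finally show ?thesis
    by (simp add: second_primitive_diff[OF \<sigma> integrable_q_particular[OF \<sigma>]])
qed

text \<open>
  For \<open>s < 1\<close>, the derivative of \<open>\<lambda>t. K t s\<close> at \<open>1\<close>, extended continuously to \<open>s = 1\<close>.
\<close>

definition end_slope :: "real \<Rightarrow> real" where
  "end_slope s = 1 - (LINT r|leb01. q r * K r s)"

lemma end_slope_continuous: "continuous_on S end_slope"
proof -
  have "continuous_on UNIV (\<lambda>s. LINT r|leb01. K r s * q r)"
    by (rule continuous_on_integral_kernel[OF q _ K_bounded])
      (unfold case_prod_unfold, intro K_continuous_compose continuous_intros)
  then have "continuous_on UNIV end_slope"
    unfolding end_slope_def by (intro continuous_intros) (simp add: mult.commute)
  then show ?thesis by (rule continuous_on_subset) simp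
qed

lemma integral_end_slope:
  assumes \<sigma>: "integrable leb01 \<sigma>"
  shows "(LINT s|leb01. end_slope s * \<sigma> s) = (LINT r|leb01. \<sigma> r - q r * particular \<sigma> r)"
proof -
  have i: "integrable leb01 (\<lambda>s. (LINT r|leb01. q r * K r s) * \<sigma> s)"
    using Bochner_Integration.integrable_diff[OF \<sigma> integrable_continuous_mult[OF \<sigma> end_slope_continuous]]
    by (simp add: end_slope_def left_diff_distrib)
  have "(LINT s|leb01. end_slope s * \<sigma> s) = (LINT s|leb01. \<sigma> s - (LINT r|leb01. q r * K r s) * \<sigma> s)"
    by (simp add: end_slope_def left_diff_distrib)
  also have "\<dots> = (LINT s|leb01. \<sigma> s) - (LINT s|leb01. (LINT r|leb01. q r * K r s) * \<sigma> s)"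
    by (rule Bochner_Integration.integral_diff[OF \<sigma> i])
  also have "\<dots> = (LINT s|leb01. \<sigma> s) - (LINT r|leb01. q r * particular \<sigma> r)"
    by (simp add: Fubini_kernel[OF q \<sigma>])
  also have "\<dots> = (LINT r|leb01. \<sigma> r - q r * particular \<sigma> r)"
    by (rule Bochner_Integration.integral_diff[symmetric, OF \<sigma> integrable_q_particular[OF \<sigma>]])
  finally show ?thesis .
qed

text \<open>
  The general solution of the inhomogeneous equation with \<open>u 0 = 0\<close>, where \<open>c\<close> is the initial
  slope. Its slope at \<open>1\<close> is an integral of \<open>\<sigma>\<close> against \<open>end_slope\<close>, just as its value there is one
  against \<open>K 1\<close>; this is why both boundary conditions have Green's functions of the same form.
\<close>

lemma shooting_solution:
  assumes \<sigma>: "integrable leb01 \<sigma>" and u: "\<forall>t\<in>I01. u t = particular \<sigma> t + c * K t 0"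
    and qa: "\<And>t. q t = a t + lam"
  shows "u \<in> W21" "u 0 = 0" "deriv01 u 0 = c"
    "deriv01 u 1 = (LINT s|leb01. end_slope s * \<sigma> s) + c * end_slope 0"
    "AE t in leb01. hill_op a lam u t = \<sigma> t"
proof -
  define g where "g r = (\<sigma> r - q r * particular \<sigma> r) - c * (q r * K r 0)" for r
  have i1: "integrable leb01 (\<lambda>r. \<sigma> r - q r * particular \<sigma> r)"
    by (intro Bochner_Integration.integrable_diff \<sigma> integrable_q_particular)
  have i2: "integrable leb01 (\<lambda>r. c * (q r * K r 0))"
    by (intro integrable_mult_right integrable_qK)
  have g: "integrable leb01 g" unfolding g_def by (intro Bochner_Integration.integrable_diff i1 i2)
  have "\<forall>t\<in>I01. u t = c * t + second_primitive g t"
  proof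
    fix t :: real assume t: "t \<in> I01"
    have "K t 0 = t - second_primitive (\<lambda>r. q r * K r 0) t" using K_eq[OF t, of 0] t by simp
    then have "c * K t 0 = c * t - c * second_primitive (\<lambda>r. q r * K r 0) t"
      by (simp add: right_diff_distrib)
    then show "u t = c * t + second_primitive g t"
      unfolding bspec[OF u t] particular_eq[OF \<sigma> t] g_def second_primitive_diff[OF i1 i2] second_primitive_mult
      by simp
  qed
  note sol = second_primitive_solution[OF g this]
  show "u \<in> W21" by (rule sol(1))
  show "u 0 = 0" by (rule sol(2))
  show "deriv01 u 0 = c" using sol(3)[of 0] primitive_0[OF g] by simp
  have "deriv01 u 1 = c + (LINT r|leb01. g r)" using sol(3)[of 1] by (simp add: primitive_1)
  also have "(LINT r|leb01. g r) = (LINT s|leb01. end_slope s * \<sigma> s) - c * (LINT r|leb01. q r * K r 0)"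
    unfolding g_def Bochner_Integration.integral_diff[OF i1 i2] integral_end_slope[OF \<sigma>] by simp
  finally show "deriv01 u 1 = (LINT s|leb01. end_slope s * \<sigma> s) + c * end_slope 0"
    by (simp add: end_slope_def algebra_simps)
  have "AE t in leb01. t \<in> I01 \<longrightarrow> hill_op a lam u t = \<sigma> t"
    using sol(4)
  proof eventually_elim
    case (elim t)
    then show ?case unfolding hill_op_def g_def qa[symmetric] by (simp add: u algebra_simps)
  qed
  then show "AE t in leb01. hill_op a lam u t = \<sigma> t" by (rule AE_leb01_in_I01)
qed

text \<open>
  The solution with zero initial data, corrected by a multiple of \<open>K t 0\<close> so that the boundary
  functional at \<open>1\<close> whose value on \<open>\<lambda>t. K t s\<close> is \<open>\<kappa> s\<close> for \<open>s < 1\<close> vanishes.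
\<close>

definition shooting_green :: "(real \<Rightarrow> real) \<Rightarrow> real \<Rightarrow> real \<Rightarrow> real" where
  "shooting_green \<kappa> t s = K t s - K t 0 * \<kappa> s / \<kappa> 0"

lemma shooting_green_continuous:
  assumes "continuous_on UNIV \<kappa>" "\<kappa> 0 \<noteq> 0"
  shows "continuous_on (I01 \<times> I01) (\<lambda>(t, s). shooting_green \<kappa> t s)"
  unfolding shooting_green_def case_prod_unfold
  by (intro continuous_intros K_continuous_compose continuous_on_compose2[OF assms(1)]) (use assms(2) in auto)

lemma integral_shooting_green:
  assumes \<sigma>: "integrable leb01 \<sigma>" and \<kappa>: "continuous_on UNIV \<kappa>"
  shows "(LINT s|leb01. shooting_green \<kappa> t s * \<sigma> s)
    = particular \<sigma> t + (- (LINT s|leb01. \<kappa> s * \<sigma> s) / \<kappa> 0) * K t 0"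
proof -
  have i: "integrable leb01 (\<lambda>s. \<kappa> s * \<sigma> s)"
    by (rule integrable_continuous_mult[OF \<sigma> continuous_on_subset[OF \<kappa>]]) simp
  have "(LINT s|leb01. shooting_green \<kappa> t s * \<sigma> s) = (LINT s|leb01. K t s * \<sigma> s - K t 0 / \<kappa> 0 * (\<kappa> s * \<sigma> s))"
    by (rule Bochner_Integration.integral_cong) (simp_all add: shooting_green_def left_diff_distrib)
  also have "\<dots> = (LINT s|leb01. K t s * \<sigma> s) - (LINT s|leb01. K t 0 / \<kappa> 0 * (\<kappa> s * \<sigma> s))"
    by (rule Bochner_Integration.integral_diff[OF integrable_K_mult[OF \<sigma>] integrable_mult_right[OF i]])
  finally show ?thesis by (simp add: particular_def)
qed

text \<open>
  Since \<open>K r s\<close> vanishes for \<open>r \<le> s\<close>, the integral term of \<open>K 1 s\<close> is at most a constant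
  times \<open>(1 - s)\<close> times the integral of \<open>\<bar>q\<bar>\<close> over \<open>{s..1}\<close>, which is \<open>o(1 - s)\<close>.
\<close>

lemma K_1_has_derivative: "(K 1 has_real_derivative - 1) (at 1 within I01)"
  unfolding has_field_derivative_iff tendsto_iff
proof (intro allI impI)
  fix e :: real assume "0 < e"
  have B: "0 \<le> B" using K_bounded[of 0 0] by linarith
  define e' where "e' = e / (B + 1)"
  have e': "0 < e'" using \<open>0 < e\<close> B by (simp add: e'_def)
  obtain d where d: "0 < d"
    "\<And>A. A \<in> lmeasurable \<Longrightarrow> measure lebesgue A < d \<Longrightarrow> (LINT s|leb01. indicator A s * \<bar>q s\<bar>) < e'"
    using integral_small_on_small_sets[OF q e'] by blast
  have "dist ((K 1 s - K 1 1) / (s - 1)) (- 1) < e" if s: "s \<in> I01" "s \<noteq> 1" "dist s 1 < d" for s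
  proof -
    let ?I = "second_primitive (\<lambda>r. q r * K r s) 1"
    have s1: "s < 1" using s by auto
    have iA: "integrable leb01 (\<lambda>r. indicator {s..1} r * \<bar>q r\<bar>)"
      using q by (intro integrable_indicator_mult) auto
    have "\<bar>?I\<bar> \<le> (LINT r|leb01. \<bar>max 0 (1 - r) * (q r * K r s)\<bar>)"
      unfolding second_primitive_def by (rule integral_abs_bound)
    also have "\<dots> \<le> (LINT r|leb01. (1 - s) * B * (indicator {s..1} r * \<bar>q r\<bar>))"
    proof (rule integral_mono)
      fix r assume "r \<in> space leb01"
      then have r: "r \<in> I01" by simp
      show "\<bar>max 0 (1 - r) * (q r * K r s)\<bar> \<le> (1 - s) * B * (indicator {s..1} r * \<bar>q r\<bar>)"
      proof (cases "r \<le> s")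
        case True
        then have "K r s = 0" using K_eq_0 r s by blast
        then show ?thesis using s1 B by simp
      next
        case False
        have "\<bar>max 0 (1 - r)\<bar> * \<bar>K r s\<bar> \<le> (1 - s) * B"
          using False r s1 by (intro mult_mono K_bounded) auto
        then have "\<bar>max 0 (1 - r)\<bar> * \<bar>K r s\<bar> * \<bar>q r\<bar> \<le> (1 - s) * B * \<bar>q r\<bar>" by (rule mult_right_mono) simp
        moreover have "\<bar>max 0 (1 - r) * (q r * K r s)\<bar> = \<bar>max 0 (1 - r)\<bar> * \<bar>K r s\<bar> * \<bar>q r\<bar>"
          by (simp only: abs_mult mult_ac)
        moreover have "indicator {s..1} r = (1::real)" using False r by simp
        ultimately show ?thesis by simp
      qed
    qed (intro integrable_abs integrable_max_mult integrable_qK, intro integrable_mult_right iA)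
    also have "\<dots> = (1 - s) * (B * (LINT r|leb01. indicator {s..1} r * \<bar>q r\<bar>))" by simp
    also have "\<dots> < (1 - s) * e"
    proof (rule mult_strict_left_mono)
      have "(LINT r|leb01. indicator {s..1} r * \<bar>q r\<bar>) < e'"
        using s s1 by (intro d(2)) (auto simp: dist_real_def)
      then have "B * (LINT r|leb01. indicator {s..1} r * \<bar>q r\<bar>) \<le> B * e'" using B by (intro mult_left_mono) auto
      also have "\<dots> < (B + 1) * e'" using e' by (simp add: algebra_simps)
      also have "\<dots> = e" using B by (simp add: e'_def)
      finally show "B * (LINT r|leb01. indicator {s..1} r * \<bar>q r\<bar>) < e" .
    qed (use s1 in simp)
    finally have I: "\<bar>?I\<bar> < (1 - s) * e" .
    have "K 1 1 = 0" by (rule K_eq_0) auto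
    moreover have "K 1 s = (1 - s) - ?I" using K_eq[of 1 s] s s1 by simp
    then have "K 1 s / (1 - s) = 1 - ?I / (1 - s)" using s1 by (simp add: diff_divide_distrib)
    moreover have "K 1 s / (s - 1) = - (K 1 s / (1 - s))" using minus_divide_right[of "K 1 s" "1 - s"] by simp
    ultimately have "(K 1 s - K 1 1) / (s - 1) - (- 1) = ?I / (1 - s)" by simp
    then show ?thesis using I s1 unfolding dist_real_def by (simp add: abs_divide divide_less_eq mult.commute)
  qed
  then show "\<forall>\<^sub>F s in at 1 within I01. dist ((K 1 s - K 1 1) / (s - 1)) (- 1) < e"
    unfolding eventually_at using d(1) by blast
qed

text \<open>
  If the boundary functional \<open>b\<close> of \<open>\<lambda>t. K t 0\<close> vanished, this solution of the homogeneous
  equation would be zero, but its initial slope is \<open>1\<close>.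
\<close>

lemma shooting_nonresonant_ne_0:
  assumes qa: "\<And>t. q t = a t + lam" and nonres: "nonresonant a lam X"
    and X: "b = 0 \<Longrightarrow> (\<lambda>t. K t 0) \<in> X"
  shows "b \<noteq> 0"
proof
  assume "b = 0"
  have "\<forall>t\<in>I01. K t 0 = particular (\<lambda>_. 0) t + 1 * K t 0" by (simp add: particular_def)
  note sol = shooting_solution[OF integrable_const_leb01 this qa]
  have "\<forall>t\<in>I01. K t 0 = 0"
    using nonres X[OF \<open>b = 0\<close>] sol(5) unfolding nonresonant_def by blast
  then have "deriv01 (\<lambda>t. K t 0) 0 = deriv01 (\<lambda>t. 0) 0"
    by (intro deriv01_cong) auto
  also have "\<dots> = 0" by (rule deriv01_eqI) auto
  finally show False using sol(3) by simp
qed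

lemma Dirichlet_denominator_ne_0:
  assumes qa: "\<And>t. q t = a t + lam" and nonres: "nonresonant a lam X_D"
  shows "K 1 0 \<noteq> 0"
proof (rule shooting_nonresonant_ne_0[OF qa nonres])
  have "\<forall>t\<in>I01. K t 0 = particular (\<lambda>_. 0) t + 1 * K t 0" by (simp add: particular_def)
  note sol = shooting_solution[OF integrable_const_leb01 this qa]
  assume "K 1 0 = 0"
  then show "(\<lambda>t. K t 0) \<in> X_D" using sol(1,2) by (simp add: X_D_def)
qed

lemma Mixed_denominator_ne_0:
  assumes qa: "\<And>t. q t = a t + lam" and nonres: "nonresonant a lam X_M2"
  shows "end_slope 0 \<noteq> 0"
proof (rule shooting_nonresonant_ne_0[OF qa nonres])
  have "\<forall>t\<in>I01. K t 0 = particular (\<lambda>_. 0) t + 1 * K t 0" by (simp add: particular_def)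
  note sol = shooting_solution[OF integrable_const_leb01 this qa]
  assume "end_slope 0 = 0"
  then show "(\<lambda>t. K t 0) \<in> X_M2" using sol(1,2,4) by (simp add: X_M2_def)
qed

lemma is_green_function_shooting:
  assumes qa: "\<And>t. q t = a t + lam" and nonres: "nonresonant a lam X" and X: "X \<subseteq> W21"
    and diff: "\<And>u w. u \<in> X \<Longrightarrow> w \<in> X \<Longrightarrow> (\<lambda>t. u t - w t) \<in> X"
    and cong: "\<And>u w. u \<in> X \<Longrightarrow> (\<And>t. t \<in> I01 \<Longrightarrow> u t = w t) \<Longrightarrow> w \<in> X"
    and \<kappa>: "continuous_on UNIV \<kappa>" "\<kappa> 0 \<noteq> 0"
    and mem: "\<And>\<sigma>. integrable leb01 \<sigma> \<Longrightarrow> (\<lambda>t. LINT s|leb01. shooting_green \<kappa> t s * \<sigma> s) \<in> X"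
  shows "is_green_function a lam X (shooting_green \<kappa>)"
proof (rule is_green_functionI[OF nonres X diff cong shooting_green_continuous[OF \<kappa>] mem])
  fix \<sigma> :: "real \<Rightarrow> real" assume \<sigma>: "integrable leb01 \<sigma>"
  show "AE t in leb01. hill_op a lam (\<lambda>t. LINT s|leb01. shooting_green \<kappa> t s * \<sigma> s) t = \<sigma> t"
    by (rule shooting_solution(5)[OF \<sigma> _ qa]) (rule ballI, rule integral_shooting_green[OF \<sigma> \<kappa>(1)])
qed

lemma Dirichlet_green:
  assumes qa: "\<And>t. q t = a t + lam" and nonres: "nonresonant a lam X_D"
  shows "is_green_function a lam X_D (shooting_green (K 1))"
proof (rule is_green_function_shooting[OF qa nonres])
  have "continuous_on UNIV (\<lambda>s. K 1 s)" by (intro K_continuous_compose continuous_on_id continuous_on_const)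
  then show c: "continuous_on UNIV (K 1)" .
  show ne: "K 1 0 \<noteq> 0" by (rule Dirichlet_denominator_ne_0[OF qa nonres])
  fix \<sigma> :: "real \<Rightarrow> real" assume \<sigma>: "integrable leb01 \<sigma>"
  note U = integral_shooting_green[OF \<sigma> c]
  note sol = shooting_solution[OF \<sigma> ballI[OF U] qa]
  have "(LINT s|leb01. shooting_green (K 1) 1 s * \<sigma> s) = 0"
    unfolding U using ne by (simp add: particular_def)
  then show "(\<lambda>t. LINT s|leb01. shooting_green (K 1) t s * \<sigma> s) \<in> X_D"
    using sol(1,2) by (simp add: X_D_def)
next
  show "X_D \<subseteq> W21" by (auto simp: X_D_def)
  show "(\<lambda>t. u t - w t) \<in> X_D" if "u \<in> X_D" "w \<in> X_D" for u w by (rule X_D_diff[OF that])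
  show "w \<in> X_D" if "u \<in> X_D" "\<And>t. t \<in> I01 \<Longrightarrow> u t = w t" for u w by (rule X_D_cong[OF that])
qed

lemma Mixed_green:
  assumes qa: "\<And>t. q t = a t + lam" and nonres: "nonresonant a lam X_M2"
  shows "is_green_function a lam X_M2 (shooting_green end_slope)"
proof (rule is_green_function_shooting[OF qa nonres])
  show "continuous_on UNIV end_slope" by (rule end_slope_continuous)
  show ne: "end_slope 0 \<noteq> 0" by (rule Mixed_denominator_ne_0[OF qa nonres])
  fix \<sigma> :: "real \<Rightarrow> real" assume \<sigma>: "integrable leb01 \<sigma>"
  note sol = shooting_solution[OF \<sigma> ballI[OF integral_shooting_green[OF \<sigma> end_slope_continuous]] qa]
  show "(\<lambda>t. LINT s|leb01. shooting_green end_slope t s * \<sigma> s) \<in> X_M2"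
    using sol(1,2,4) ne by (simp add: X_M2_def)
next
  show "X_M2 \<subseteq> W21" by (auto simp: X_M2_def)
  show "(\<lambda>t. u t - w t) \<in> X_M2" if "u \<in> X_M2" "w \<in> X_M2" for u w by (rule X_M2_diff[OF that])
  show "w \<in> X_M2" if "u \<in> X_M2" "\<And>t. t \<in> I01 \<Longrightarrow> u t = w t" for u w by (rule X_M2_cong[OF that])
qed

lemma r2_eq:
  assumes qa: "\<And>t. q t = a t + lam" and nonres: "nonresonant a lam X_D" and t: "t \<in> I01"
  shows "r2 a lam t = K t 0 / K 1 0"
proof -
  have ne: "K 1 0 \<noteq> 0" by (rule Dirichlet_denominator_ne_0[OF qa nonres])
  let ?P = "\<lambda>u. u \<in> W21 \<and> (AE t in leb01. hill_op a lam u t = 0) \<and> u 0 = 0 \<and> u 1 = 1"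
  let ?r = "\<lambda>t. K t 0 / K 1 0"
  have "\<forall>t\<in>I01. ?r t = particular (\<lambda>_. 0) t + 1 / K 1 0 * K t 0" by (simp add: particular_def)
  note sol = shooting_solution[OF integrable_const_leb01 this qa]
  have r: "?P ?r" using sol(1,2,5) ne by simp
  have s: "?P (r2 a lam)" unfolding r2_def by (rule someI[of ?P, OF r])
  have "(\<lambda>t. r2 a lam t - ?r t) \<in> X_D"
    using r s W21_diff(1)[of "r2 a lam" ?r] by (simp add: X_D_def)
  moreover have "AE t in leb01. hill_op a lam (\<lambda>t. r2 a lam t - ?r t) t = 0"
    using r s by (intro hill_op_diff_AE) auto
  ultimately have "\<forall>t\<in>I01. r2 a lam t - ?r t = 0" using nonres unfolding nonresonant_def by blast
  then show ?thesis using t by simp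
qed

text \<open>
  For \<open>s\<close> close to \<open>1\<close> one has \<open>t \<le> s\<close>, so only the multiple of \<open>K 1 s\<close> remains.
\<close>

lemma Dirichlet_green_has_derivative:
  assumes t: "0 < t" "t < 1" and G: "\<And>s. s \<in> I01 \<Longrightarrow> g s = shooting_green (K 1) t s"
  shows "(g has_real_derivative K t 0 / K 1 0) (at 1 within I01)"
proof (rule has_field_derivative_transform_within[of _ _ _ _ "1 - t"])
  show "((\<lambda>s. - (K t 0 / K 1 0) * K 1 s) has_real_derivative K t 0 / K 1 0) (at 1 within I01)"
    using DERIV_cmult[OF K_1_has_derivative, of "- (K t 0 / K 1 0)"] by simp
  fix s assume s: "s \<in> I01" "dist s 1 < 1 - t"
  then have "t \<le> s" by (auto simp: dist_real_def)
  then have "K t s = 0" using s t by (intro K_eq_0) auto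
  then show "- (K t 0 / K 1 0) * K 1 s = g s" using G[OF s(1)] by (simp add: shooting_green_def)
qed (use t in auto)

lemma ds_at_1_Dirichlet_green:
  assumes G: "\<And>t s. t \<in> I01 \<Longrightarrow> s \<in> I01 \<Longrightarrow> G t s = shooting_green (K 1) t s"
  shows "ds_at_1_exists G" and "\<And>t. t \<in> I01 \<Longrightarrow> ds_at_1 G t = K t 0 / K 1 0"
proof -
  have D: "(G t has_real_derivative K t 0 / K 1 0) (at 1 within I01)" if "t \<in> {0<..<1}" for t
    by (rule Dirichlet_green_has_derivative) (use that G in auto)
  have d: "deriv01 (G t) 1 = K t 0 / K 1 0" if "t \<in> {0<..<1}" for t
    by (rule deriv01_eqI[OF _ D[OF that]]) simp
  have lim: "((\<lambda>\<tau>. deriv01 (G \<tau>) 1) \<longlongrightarrow> K t 0 / K 1 0) (at t within {0<..<1})" for t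
  proof (rule Lim_transform_eventually)
    have "continuous_on UNIV (\<lambda>\<tau>. K \<tau> 0)" by (intro K_continuous_compose continuous_on_id continuous_on_const)
    then have "((\<lambda>\<tau>. K \<tau> 0) \<longlongrightarrow> K t 0) (at t within {0<..<1})"
      by (metis UNIV_I continuous_on_def tendsto_within_subset top_greatest)
    then show "((\<lambda>\<tau>. K \<tau> 0 / K 1 0) \<longlongrightarrow> K t 0 / K 1 0) (at t within {0<..<1})"
      unfolding divide_inverse by (intro tendsto_intros)
    show "\<forall>\<^sub>F \<tau> in at t within {0<..<1}. K \<tau> 0 / K 1 0 = deriv01 (G \<tau>) 1"
      unfolding eventually_at_filter by (rule always_eventually) (use d in auto)
  qed
  show "ds_at_1_exists G"
    unfolding ds_at_1_exists_def using D lim real_differentiable_def by blast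
  show "ds_at_1 G t = K t 0 / K 1 0" if t: "t \<in> I01" for t
  proof (cases "t \<in> {0<..<1}")
    case True
    then show ?thesis using d by (simp add: ds_at_1_def)
  next
    case False
    then have "t = 0 \<or> t = 1" using t by auto
    then have "at t within {0<..<1} \<noteq> bot"
      using islimpt_greaterThanLessThan1[of 0 "1::real"] islimpt_greaterThanLessThan2[of 0 "1::real"]
      by (auto simp: trivial_limit_within)
    then have "Lim (at t within {0<..<1}) (\<lambda>\<tau>. deriv01 (G \<tau>) 1) = K t 0 / K 1 0"
      by (rule tendsto_Lim) (rule lim)
    then show ?thesis using False by (simp add: ds_at_1_def del: greaterThanLessThan_iff)
  qed
qed

end

section \<open>Comparison of the two Green's functions\<close>

theorem theorem3p19:
  fixes a :: "real \<Rightarrow> real" and lam :: real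
  assumes "integrable leb01 a"
    and "nonresonant a lam X_D"
    and "nonresonant a lam X_M2"
  shows "ds_at_1_exists (G_D a lam) \<and>
    (\<forall>t\<in>I01. \<forall>s\<in>I01.
       G_M2 a lam t s = G_D a lam t s + r2 a lam t * G_M2 a lam 1 s \<and>
       G_D a lam t s + r2 a lam t * G_M2 a lam 1 s =
         G_D a lam t s + ds_at_1 (G_D a lam) t * G_M2 a lam 1 s)"
proof -
  let ?q = "\<lambda>t. a t + lam"
  have q: "integrable leb01 ?q"
    by (intro Bochner_Integration.integrable_add assms(1) integrable_const_leb01)
  obtain K B where "Cauchy_kernel ?q K B" using Cauchy_kernel_exists[OF q] by blast
  then interpret Cauchy_kernel ?q K B .
  have GD: "G_D a lam t s = shooting_green (K 1) t s" if "t \<in> I01" "s \<in> I01" for t s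
    by (rule green_eq[OF Dirichlet_green[OF refl assms(2)] that])
  have GM: "G_M2 a lam t s = shooting_green end_slope t s" if "t \<in> I01" "s \<in> I01" for t s
    by (rule green_eq[OF Mixed_green[OF refl assms(3)] that])
  note r = r2_eq[OF refl assms(2)]
  have ds1: "ds_at_1_exists (G_D a lam)" by (rule ds_at_1_Dirichlet_green(1)[OF GD])
  have ds2: "ds_at_1 (G_D a lam) t = K t 0 / K 1 0" if "t \<in> I01" for t
    by (rule ds_at_1_Dirichlet_green(2)[OF GD that])
  have ne: "K 1 0 \<noteq> 0" by (rule Dirichlet_denominator_ne_0[OF refl assms(2)])
  have eq: "shooting_green end_slope t s = shooting_green (K 1) t s + K t 0 / K 1 0 * shooting_green end_slope 1 s" for t s
    unfolding shooting_green_def using ne by (simp add: right_diff_distrib)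
  have one: "1 \<in> I01" by simp
  show ?thesis
  proof (intro conjI ballI ds1)
    fix t s :: real assume t: "t \<in> I01" and s: "s \<in> I01"
    show "G_M2 a lam t s = G_D a lam t s + r2 a lam t * G_M2 a lam 1 s"
      unfolding GD[OF t s] GM[OF t s] GM[OF one s] r[OF t] by (rule eq)
    show "G_D a lam t s + r2 a lam t * G_M2 a lam 1 s
        = G_D a lam t s + ds_at_1 (G_D a lam) t * G_M2 a lam 1 s"
      unfolding r[OF t] ds2[OF t] by (rule refl)
  qed
qed

end
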